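(* Let $\mathcal H$ be a real Hilbert space, $\gamma>0$, $\beta\ge0$. Let $f\in C^1(\mathcal H)$ be real-valued with $\inf_{\mathcal H}f>-\infty$ and $\nabla f$ globally $L$-Lipschitz continuous for some $L\ge0$. Let $\phi:\mathcal H\to\mathbb R\cup\{+\infty\}$ be proper, lower semicontinuous and convex with $\phi(0)=\min\phi=0$ and $r\mathbb B\subseteq\partial\phi(0)$ for some $r>0$. Let $x_0\in\mathcal H$, $v_0\in\mathrm{Dom}(\partial\phi)$, and let $(x,v)$, $v=\dot x$, be the global strong solution of $$\ddot x(t)+\gamma\dot x(t)+\partial\phi(\dot x(t))+\nabla f(x(t)+\beta\dot x(t))\ni 0,\quad t\ge0,\qquad x(0)=x_0,\ \dot x(0)=v_0.$$ For $h>0$ let $(x_k^h,v_k^h)_{k\ge0}$ be generated from $(x_0^h,v_0^h)=(x_0,v_0)$ by $$\frac{v_{k+1}^h-v_k^h}{h}+\gamma v_{k+1}^h+\partial\phi(v_{k+1}^h)+\nabla f(x_k^h+\beta v_k^h)\ni0,\qquad \frac{x_{k+1}^h-x_k^h}{h}=v_{k+1}^h,$$ and let $(x_h,v_h)$ be the continuous piecewise affine interpolants: with $t_k=kh$, for $t\in[t_k,t_{k+1}]$, $$x_h(t)=x_k^h+(t-t_k)v_{k+1}^h,\qquad v_h(t)=v_k^h+(t-t_k)\frac{v_{k+1}^h-v_k^h}{h}.$$ Then for every $T>0$ there exist $C_T>0$ and $h_T>0$ such that for every $0<h\le h_T$, $$\sup_{0\le t\le T}\left(\|x_h(t)-x(t)\|+\|v_h(t)-v(t)\|\right)\le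 C_T\sqrt h .$$
   Context: $\mathbb B$ is the closed unit ball; $\partial\phi$ is the convex subdifferential and $\mathrm{Dom}(\partial\phi)=\{v:\partial\phi(v)\ne\varnothing\}$. A strong solution on $[0,T]$ is a pair $(x,v)$ with $x,v\in W^{1,2}(0,T;\mathcal H)$, $v=\dot x$ a.e., $x(0)=x_0$, $v(0)=v_0$, and some $\xi\in L^2(0,T;\mathcal H)$ with $\xi(t)\in\partial\phi(v(t))$ and $\dot v+\gamma v+\xi+\nabla f(x+\beta v)=0$ a.e. on $(0,T)$; a global strong solution is one whose restriction to every $[0,T]$ is strong (it exists and is unique here). The discrete recursion is uniquely solvable: $v_{k+1}^h=\mathrm{prox}_{\lambda_h\phi}\bigl(\frac{1}{1+h\gamma}v_k^h-\lambda_h\nabla f(x_k^h+\beta v_k^h)\bigr)$, $\lambda_h=\frac{h}{1+h\gamma}$. *)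

theory Defs
  imports "HOL-Analysis.Analysis"
begin

section \<open>Convex analysis for extended-real-valued functions\<close>

definition proper_ereal :: "('a \<Rightarrow> ereal) \<Rightarrow> bool" where
  "proper_ereal \<phi> \<longleftrightarrow> (\<forall>v. \<phi> v \<noteq> -\<infinity>) \<and> (\<exists>v. \<phi> v \<noteq> \<infinity>)"

text \<open>Since \<^term>\<open>nhds v\<close> is not punctured at \<open>v\<close>, the inequality is in fact an equality.\<close>

definition lsc_ereal :: "('a::topological_space \<Rightarrow> ereal) \<Rightarrow> bool" where
  "lsc_ereal \<phi> \<longleftrightarrow> (\<forall>v. \<phi> v \<le> Liminf (nhds v) \<phi>)"

text \<open>Only meaningful for functions that never take the value \<open>-\<infinity>\<close>; the ereal convention
  \<open>0 * \<infinity> = 0\<close> makes the inequality trivial at the end points \<open>s = 0\<close> and \<open>s = 1\<close>.\<close>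

definition convex_ereal :: "('a::real_vector \<Rightarrow> ereal) \<Rightarrow> bool" where
  "convex_ereal \<phi> \<longleftrightarrow> (\<forall>u w. \<forall>s\<in>{0..1}.
     \<phi> ((1 - s) *\<^sub>R u + s *\<^sub>R w) \<le> ereal (1 - s) * \<phi> u + ereal s * \<phi> w)"

text \<open>For proper \<open>\<phi>\<close> this set is empty wherever \<open>\<phi> v = \<infinity>\<close>.\<close>

definition subdiff :: "('a::real_inner \<Rightarrow> ereal) \<Rightarrow> 'a \<Rightarrow> 'a set" where
  "subdiff \<phi> v = {\<xi>. \<forall>w. \<phi> v + ereal (\<xi> \<bullet> (w - v)) \<le> \<phi> w}"

definition dom_subdiff :: "('a::real_inner \<Rightarrow> ereal) \<Rightarrow> 'a set" where
  "dom_subdiff \<phi> = {v. subdiff \<phi> v \<noteq> {}}"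


section \<open>Lebesgue and Sobolev spaces of vector-valued functions on \<open>(0,T)\<close>\<close>

text \<open>The Bochner integral of the library assumes a second countable codomain, whereas the
  Hilbert space here need not be separable. Strong measurability is therefore stated explicitly,
  as a.e. approximability by simple functions.\<close>

definition strongly_measurable :: "'b measure \<Rightarrow> ('b \<Rightarrow> 'a::real_normed_vector) \<Rightarrow> bool" where
  "strongly_measurable M u \<longleftrightarrow> (\<exists>s :: nat \<Rightarrow> 'b \<Rightarrow> 'a.
     (\<forall>n. simple_function M (s n)) \<and> (AE t in M. (\<lambda>n. s n t) \<longlonglongrightarrow> u t))"

definition L2_fun :: "real \<Rightarrow> (real \<Rightarrow> 'a::real_normed_vector) \<Rightarrow> bool" where
  "L2_fun T u \<longleftrightarrow> strongly_measurable (lebesgue_on {0<..<T}) u \<and>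
     (\<integral>\<^sup>+t. ennreal ((norm (u t))\<^sup>2) \<partial>lebesgue_on {0<..<T}) < \<infinity>"

text \<open>The space of smooth real functions with compact support in \<open>(0,T)\<close>.\<close>

definition test_funs :: "real \<Rightarrow> (real \<Rightarrow> real) set" where
  "test_funs T = {\<psi>. (\<forall>n. (deriv ^^ n) \<psi> differentiable_on UNIV) \<and>
     (\<exists>a b. 0 < a \<and> b < T \<and> (\<forall>t. t \<notin> {a..b} \<longrightarrow> \<psi> t = 0))}"

text \<open>\<open>g\<close> is the weak (distributional) derivative of \<open>u\<close>:
  \<open>\<integral> \<psi>' u = - \<integral> \<psi> g\<close> for all test functions \<open>\<psi>\<close>.
  The definition is only used for \<open>u\<close> and \<open>g\<close> in \<open>L\<^sup>2(0,T)\<close>. Both integrands are then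
  Bochner integrable, and the gauge integral used here, which the library provides for arbitrary
  normed spaces, exists and coincides with the Bochner integral.\<close>

definition weak_deriv ::
    "real \<Rightarrow> (real \<Rightarrow> 'a::real_normed_vector) \<Rightarrow> (real \<Rightarrow> 'a) \<Rightarrow> bool" where
  "weak_deriv T u g \<longleftrightarrow> (\<forall>\<psi>\<in>test_funs T. \<exists>J.
     ((\<lambda>t. deriv \<psi> t *\<^sub>R u t) has_integral - J) {0..T} \<and>
     ((\<lambda>t. \<psi> t *\<^sub>R g t) has_integral J) {0..T})"

text \<open>\<open>u \<in> W\<^sup>1\<^sup>,\<^sup>2(0,T)\<close> with weak derivative \<open>g\<close>. As usual \<open>u\<close> is identified
  with its continuous representative on \<open>[0,T]\<close>, so that its pointwise values make sense.\<close>

definition W12_deriv ::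
    "real \<Rightarrow> (real \<Rightarrow> 'a::real_normed_vector) \<Rightarrow> (real \<Rightarrow> 'a) \<Rightarrow> bool" where
  "W12_deriv T u g \<longleftrightarrow>
     continuous_on {0..T} u \<and> L2_fun T u \<and> L2_fun T g \<and> weak_deriv T u g"


section \<open>The evolution inclusion and its discretization\<close>

text \<open>In the following, \<open>G\<close> stands for the gradient of \<open>f\<close>. The functions \<open>dx\<close> and
  \<open>dv\<close> are the (a.e. unique) weak derivatives of \<open>x\<close> and \<open>v\<close>.\<close>

definition strong_solution ::
    "('a::real_inner \<Rightarrow> ereal) \<Rightarrow> ('a \<Rightarrow> 'a) \<Rightarrow> real \<Rightarrow> real \<Rightarrow> 'a \<Rightarrow> 'a \<Rightarrow> real \<Rightarrow>
     (real \<Rightarrow> 'a) \<Rightarrow> (real \<Rightarrow> 'a) \<Rightarrow> bool" where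
  "strong_solution \<phi> G \<gamma> \<beta> x0 v0 T x v \<longleftrightarrow>
     x 0 = x0 \<and> v 0 = v0 \<and>
     (\<exists>dx dv \<xi>. W12_deriv T x dx \<and> W12_deriv T v dv \<and> L2_fun T \<xi> \<and>
        (AE t in lebesgue_on {0<..<T}. v t = dx t) \<and>
        (AE t in lebesgue_on {0<..<T}. \<xi> t \<in> subdiff \<phi> (v t) \<and>
           dv t + \<gamma> *\<^sub>R v t + \<xi> t + G (x t + \<beta> *\<^sub>R v t) = 0))"

definition global_strong_solution ::
    "('a::real_inner \<Rightarrow> ereal) \<Rightarrow> ('a \<Rightarrow> 'a) \<Rightarrow> real \<Rightarrow> real \<Rightarrow> 'a \<Rightarrow> 'a \<Rightarrow>
     (real \<Rightarrow> 'a) \<Rightarrow> (real \<Rightarrow> 'a) \<Rightarrow> bool" where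
  "global_strong_solution \<phi> G \<gamma> \<beta> x0 v0 x v \<longleftrightarrow>
     (\<forall>T>0. strong_solution \<phi> G \<gamma> \<beta> x0 v0 T x v)"

definition discrete_scheme ::
    "('a::real_inner \<Rightarrow> ereal) \<Rightarrow> ('a \<Rightarrow> 'a) \<Rightarrow> real \<Rightarrow> real \<Rightarrow> 'a \<Rightarrow> 'a \<Rightarrow> real \<Rightarrow>
     (nat \<Rightarrow> 'a) \<Rightarrow> (nat \<Rightarrow> 'a) \<Rightarrow> bool" where
  "discrete_scheme \<phi> G \<gamma> \<beta> x0 v0 h xs vs \<longleftrightarrow>
     xs 0 = x0 \<and> vs 0 = v0 \<and>
     (\<forall>k. (\<exists>\<xi>\<in>subdiff \<phi> (vs (Suc k)).
             (1 / h) *\<^sub>R (vs (Suc k) - vs k) + \<gamma> *\<^sub>R vs (Suc k) + \<xi> + G (xs k + \<beta> *\<^sub>R vs k) = 0) \<and>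
          (1 / h) *\<^sub>R (xs (Suc k) - xs k) = vs (Suc k))"

text \<open>Interpolants on \<open>[0,\<infinity>)\<close> with \<open>t\<^sub>k = k h\<close>. The floor selects the index with
  \<open>t\<^sub>k \<le> t < t\<^sub>k\<^sub>+\<^sub>1\<close>; for sequences satisfying the scheme the same formulas hold on
  the closed interval \<open>[t\<^sub>k, t\<^sub>k\<^sub>+\<^sub>1]\<close>.\<close>

definition interp_x :: "real \<Rightarrow> (nat \<Rightarrow> 'a::real_vector) \<Rightarrow> (nat \<Rightarrow> 'a) \<Rightarrow> real \<Rightarrow> 'a" where
  "interp_x h xs vs t = (let k = nat \<lfloor>t / h\<rfloor> in xs k + (t - real k * h) *\<^sub>R vs (Suc k))"

definition interp_v :: "real \<Rightarrow> (nat \<Rightarrow> 'a::real_vector) \<Rightarrow> real \<Rightarrow> 'a" where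
  "interp_v h vs t = (let k = nat \<lfloor>t / h\<rfloor> in
     vs k + (t - real k * h) *\<^sub>R ((1 / h) *\<^sub>R (vs (Suc k) - vs k)))"

end

theory Submission
  imports Defs
begin

text \<open>The discrete velocities have bounded difference quotients: two consecutive steps are compared
  by monotonicity of \<open>\<partial>\<phi>\<close>, and the first step is compared with the initial datum, which is where
  \<open>v\<^sub>0 \<in> Dom (\<partial>\<phi>)\<close> enters. On a step let \<open>F = norm (x\<^sub>h - x)\<^sup>2 + norm (v\<^sub>h - v)\<^sup>2\<close>. The
  velocity \<open>v\<^sub>k\<^sub>+\<^sub>1\<close> at which the scheme takes its subgradient differs from \<open>v\<^sub>h\<close> by \<open>O(h)\<close>, so
  monotonicity gives \<open>F' \<le> K F + K h (1 + norm v')\<close>. Since \<open>v'\<close> is integrable, Gronwall yields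
  \<open>F = O(h)\<close>, hence an error of order \<open>\<surd>h\<close>. The differential inequality makes sense without
  pointwise differentiability of \<open>v\<close>: the weak derivative is a Pettis derivative, and this suffices
  for the energy identity.\<close>

section \<open>Smooth cutoff functions\<close>

text \<open>The loss from h to the square root of h comes from one term. Monotonicity needs the test
  vector v_(k+1) - v(t), while the energy produces v_h(t) - v(t). The mismatch is multiplied by v_h'
  - v', which is bounded by a constant plus \<open>norm v'\<close> but is not small, so the squared
  error receives a forcing of first order in h.

  The obstacle is on the continuous side: the solution is known only through integrals against
  smooth compactly supported functions, with values in a space that may be nonseparable. Pairing
  with a fixed vector leaves scalar functions, and their increments are recovered by testing with
  smooth approximations of indicators. Such functions have to be constructed explicitly, starting
  from exp(-1/t).\<close>

definition flat_exp :: "nat \<Rightarrow> real \<Rightarrow> real" where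
  "flat_exp k t = (if t \<le> 0 then 0 else (1 / t) ^ k * exp (- (1 / t)))"

lemma flat_exp_tendsto_0: "(flat_exp k \<longlongrightarrow> 0) (at 0)"
proof -
  have "((\<lambda>t. (inverse t) ^ k / exp (inverse t)) \<longlongrightarrow> (0::real)) (at_right 0)"
    by (rule filterlim_compose[OF tendsto_power_div_exp_0 filterlim_inverse_at_top_right])
  then have R: "(flat_exp k \<longlongrightarrow> 0) (at_right 0)"
    by (rule Lim_transform_eventually)
       (auto simp: eventually_at_right_field flat_exp_def exp_minus divide_simps intro!: exI[of _ 1])
  have "((\<lambda>_. 0) \<longlongrightarrow> (0::real)) (at_left 0)" by simp
  then have "(flat_exp k \<longlongrightarrow> 0) (at_left 0)"
    by (rule Lim_transform_eventually)
       (auto simp: eventually_at_left_field flat_exp_def intro!: exI[of _ "-1"])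
  with R show ?thesis by (simp add: filterlim_split_at)
qed

text \<open>Derivatives of exp(-1/t) are exp(-1/t) times polynomials in 1/t; the index
  \<open>k\<close> counts the power of 1/t, so the family is closed under differentiation up to
  linear combinations. At 0 the difference quotient of \<open>flat_exp k\<close> is
  \<open>flat_exp (k + 1)\<close>, which tends to 0 from both sides.\<close>

lemma flat_exp_has_real_derivative:
  "(flat_exp k has_real_derivative flat_exp (k + 2) t - real k * flat_exp (k + 1) t) (at t)"
proof -
  consider "t < 0" | "t = 0" | "t > 0" by linarith
  then show ?thesis
  proof cases
    case 1
    have "((\<lambda>_. 0) has_real_derivative 0) (at t)" by simp
    then have "(flat_exp k has_real_derivative 0) (at t)"
      by (rule has_field_derivative_transform_within_open[where S="{..<0}"])
         (use 1 in \<open>auto simp: flat_exp_def\<close>)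
    with 1 show ?thesis by (simp add: flat_exp_def)
  next
    case 2
    have "((\<lambda>h. (flat_exp k (0 + h) - flat_exp k 0) / h) \<longlongrightarrow> 0) (at 0)"
      by (rule Lim_transform_eventually[OF flat_exp_tendsto_0[of "k + 1"]])
         (auto simp: eventually_at_filter flat_exp_def)
    then show ?thesis using 2 by (simp add: DERIV_def flat_exp_def)
  next
    case 3
    have "((\<lambda>t. (1 / t) ^ k * exp (- (1 / t))) has_real_derivative
        flat_exp (k + 2) t - real k * flat_exp (k + 1) t) (at t)"
      using 3
      by (auto intro!: derivative_eq_intros simp: flat_exp_def field_simps power2_eq_square)
         (cases k; simp add: field_simps)
    then show ?thesis
      by (rule has_field_derivative_transform_within_open[where S="{0<..}"])
         (use 3 in \<open>auto simp: flat_exp_def\<close>)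
  qed
qed

text \<open>The rules are chosen so that the derivative of each generator can again be generated; this
  gives smoothness without a Leibniz formula for higher derivatives.\<close>

inductive smooth_fun :: "(real \<Rightarrow> real) \<Rightarrow> bool" where
  flat: "smooth_fun (flat_exp k)"
| const: "smooth_fun (\<lambda>_. c)"
| add: "smooth_fun f \<Longrightarrow> smooth_fun g \<Longrightarrow> smooth_fun (\<lambda>t. f t + g t)"
| mult: "smooth_fun f \<Longrightarrow> smooth_fun g \<Longrightarrow> smooth_fun (\<lambda>t. f t * g t)"
| inverse: "smooth_fun f \<Longrightarrow> (\<And>t. f t \<noteq> 0) \<Longrightarrow> smooth_fun (\<lambda>t. inverse (f t))"
| affine: "smooth_fun f \<Longrightarrow> smooth_fun (\<lambda>t. f (a * t + b))"

lemma smooth_fun_cmult: "smooth_fun f \<Longrightarrow> smooth_fun (\<lambda>t. c * f t)"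
  by (rule smooth_fun.mult[OF smooth_fun.const])

lemma smooth_fun_diff: "smooth_fun f \<Longrightarrow> smooth_fun g \<Longrightarrow> smooth_fun (\<lambda>t. f t - g t)"
  using smooth_fun.add[OF _ smooth_fun_cmult[of g "-1"]] by simp

lemma smooth_fun_derivative:
  assumes "smooth_fun f"
  shows "\<exists>f'. smooth_fun f' \<and> (\<forall>t. (f has_real_derivative f' t) (at t))"
  using assms
proof induction
  case (flat k)
  have "smooth_fun (\<lambda>t. flat_exp (k + 2) t - real k * flat_exp (k + 1) t)"
    by (intro smooth_fun_diff smooth_fun_cmult smooth_fun.flat)
  then show ?case using flat_exp_has_real_derivative by blast
next
  case (const c)
  show ?case using smooth_fun.const[of 0] by (intro exI[of _ "\<lambda>_. 0"]) auto
next
  case (add f g)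
  then obtain f' g' where "smooth_fun f'" "smooth_fun g'"
    "\<And>t. (f has_real_derivative f' t) (at t)" "\<And>t. (g has_real_derivative g' t) (at t)" by blast
  then show ?case
    by (intro exI[of _ "\<lambda>t. f' t + g' t"]) (auto intro!: smooth_fun.add derivative_eq_intros)
next
  case (mult f g)
  then obtain f' g' where "smooth_fun f'" "smooth_fun g'"
    "\<And>t. (f has_real_derivative f' t) (at t)" "\<And>t. (g has_real_derivative g' t) (at t)" by blast
  then show ?case using mult
    by (intro exI[of _ "\<lambda>t. f' t * g t + g' t * f t"])
       (auto intro!: smooth_fun.intros derivative_eq_intros)
next
  case (inverse f)
  then obtain f' where "smooth_fun f'" "\<And>t. (f has_real_derivative f' t) (at t)" by blast
  moreover from this inverse have "smooth_fun (\<lambda>t. - 1 * (f' t * (inverse (f t) * inverse (f t))))"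
    by (intro smooth_fun_cmult smooth_fun.mult smooth_fun.inverse) auto
  ultimately show ?case using inverse
    by (intro exI[of _ "\<lambda>t. - 1 * (f' t * (inverse (f t) * inverse (f t)))"] conjI)
       (auto intro!: derivative_eq_intros)
next
  case (affine f a b)
  then obtain f' where f': "smooth_fun f'" "\<And>t. (f has_real_derivative f' t) (at t)" by blast
  have "((\<lambda>t. a * t + b) has_real_derivative a) (at t)" for t
    by (auto intro!: derivative_eq_intros)
  note DERIV_cong[OF DERIV_chain2[OF f'(2) this] mult.commute]
  then show ?case using f'
    by (intro exI[of _ "\<lambda>t. a * f' (a * t + b)"])
       (auto intro!: smooth_fun.affine smooth_fun_cmult)
qed

lemma smooth_fun_deriv: "smooth_fun f \<Longrightarrow> smooth_fun (deriv f)"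
proof -
  assume "smooth_fun f"
  then obtain f' where "smooth_fun f'" "\<And>t. (f has_real_derivative f' t) (at t)"
    using smooth_fun_derivative by blast
  then show ?thesis by (metis DERIV_imp_deriv ext)
qed

lemma smooth_fun_has_real_derivative:
  "smooth_fun f \<Longrightarrow> (f has_real_derivative deriv f t) (at t)"
  using smooth_fun_derivative DERIV_imp_deriv by metis

lemma smooth_fun_iterated_deriv:
  assumes "smooth_fun f"
  shows "(deriv ^^ n) f differentiable_on UNIV"
proof -
  have "smooth_fun ((deriv ^^ n) f)"
    by (induction n) (use assms smooth_fun_deriv in auto)
  then show ?thesis
    using smooth_fun_has_real_derivative
    by (auto simp: differentiable_on_def real_differentiable_def)
qed

text \<open>The quotient p(t) / (p(t) + p(1 - t)) with p = \<open>flat_exp 0\<close>; t and 1 - t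
  are never both nonpositive, so the denominator is positive. The spelling with
  \<open>inverse\<close> and \<open>- 1 * t + 1\<close> matches the generating rules of
  \<open>smooth_fun\<close>.\<close>

definition smooth_step :: "real \<Rightarrow> real" where
  "smooth_step t = flat_exp 0 t * inverse (flat_exp 0 t + flat_exp 0 (- 1 * t + 1))"

lemma smooth_fun_smooth_step: "smooth_fun smooth_step"
  unfolding smooth_step_def[abs_def]
proof (intro smooth_fun.mult smooth_fun.inverse smooth_fun.add smooth_fun.flat smooth_fun.affine)
  fix t show "flat_exp 0 t + flat_exp 0 (- 1 * t + 1) \<noteq> 0"
    by (cases "t \<le> 0") (auto simp: flat_exp_def add_nonneg_eq_0_iff)
qed

lemma smooth_step_eq_0: "t \<le> 0 \<Longrightarrow> smooth_step t = 0"
  and smooth_step_eq_1: "t \<ge> 1 \<Longrightarrow> smooth_step t = 1"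
  by (auto simp: smooth_step_def flat_exp_def)

lemma smooth_step_bounds: "0 \<le> smooth_step t" "smooth_step t \<le> 1"
proof -
  have nn: "flat_exp 0 s \<ge> 0" for s by (simp add: flat_exp_def)
  show "0 \<le> smooth_step t" by (simp add: smooth_step_def nn)
  show "smooth_step t \<le> 1"
    using nn[of t] nn[of "- 1 * t + 1"]
    by (simp add: smooth_step_def divide_simps flip: divide_inverse)
qed

text \<open>The quotient rule has numerator p' q - p q' with p increasing and q decreasing. Thanks
  to the sign, the scaled derivative serves as a probability density, and averages against it are
  controlled by oscillation.\<close>

lemma deriv_smooth_step_nonneg: "deriv smooth_step t \<ge> 0"
proof -
  define p q where "p = flat_exp 0" and "q = (\<lambda>t. flat_exp 0 (- 1 * t + 1))"
  have p: "(p has_real_derivative flat_exp 2 t) (at t)"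
    using flat_exp_has_real_derivative[of 0 t] by (simp add: p_def numeral_2_eq_2)
  have "((\<lambda>t. - 1 * t + 1) has_real_derivative - 1) (at t)"
    by (auto intro!: derivative_eq_intros)
  then have q: "(q has_real_derivative - flat_exp 2 (- 1 * t + 1)) (at t)"
    unfolding q_def
    by (rule DERIV_cong[OF DERIV_chain2[OF flat_exp_has_real_derivative]])
       (simp add: numeral_2_eq_2)
  have ne: "p t + q t > 0"
    by (auto simp: p_def q_def flat_exp_def add_pos_pos)
  have "((\<lambda>t. p t / (p t + q t)) has_real_derivative
     (flat_exp 2 t * q t + p t * flat_exp 2 (- 1 * t + 1)) / (p t + q t)\<^sup>2) (at t)"
    using ne by (auto intro!: derivative_eq_intros p q simp: field_simps power2_eq_square)
  moreover have "(\<lambda>t. p t / (p t + q t)) = smooth_step"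
    by (simp add: fun_eq_iff smooth_step_def p_def q_def divide_inverse)
  ultimately have "deriv smooth_step t = (flat_exp 2 t * q t + p t * flat_exp 2 (- 1 * t + 1)) / (p t + q t)\<^sup>2"
    by (metis DERIV_imp_deriv)
  moreover have "flat_exp k s \<ge> 0" for k s by (simp add: flat_exp_def)
  ultimately show ?thesis by (simp add: p_def q_def)
qed

section \<open>Integrability of strongly measurable functions\<close>

text \<open>A simple function takes finitely many values, so \<open>\<Phi> t (s n t)\<close> is
  measurable piece by piece, and continuity in the second argument passes to the limit. Applied to
  norms and to inner products with a continuous function, this reduces measurability questions to
  real-valued functions.\<close>

lemma strongly_measurable_Caratheodory:
  fixes \<Phi> :: "'b \<Rightarrow> 'a::real_normed_vector \<Rightarrow> real"
  assumes u: "strongly_measurable M u"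
    and meas: "\<And>c. (\<lambda>t. \<Phi> t c) \<in> borel_measurable M"
    and cont: "\<And>t c. isCont (\<Phi> t) c"
  shows "\<exists>w\<in>borel_measurable M. AE t in M. \<Phi> t (u t) = w t"
proof -
  obtain s :: "nat \<Rightarrow> 'b \<Rightarrow> 'a" where s: "\<And>n. simple_function M (s n)"
    and lim: "AE t in M. (\<lambda>n. s n t) \<longlonglongrightarrow> u t"
    using u unfolding strongly_measurable_def by blast
  have "(\<lambda>t. \<Phi> t (s n t)) \<in> borel_measurable M" for n
  proof (rule measurable_compose_countable'[where I = "s n ` space M"])
    show "s n \<in> measurable M (count_space (s n ` space M))"
      using s[of n] by (simp add: simple_function_def measurable_count_space_eq2)
    show "countable (s n ` space M)"
      using s[of n] by (simp add: simple_function_def countable_finite)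
  qed (rule meas)
  \<comment> \<open>Where \<open>s n t\<close> does not converge to \<open>u t\<close>, the value of
    \<open>lim\<close> may be arbitrary; this happens on a null set only.\<close>
  then have "(\<lambda>t. lim (\<lambda>n. \<Phi> t (s n t))) \<in> borel_measurable M"
    by (rule borel_measurable_lim_metric)
  moreover have "AE t in M. \<Phi> t (u t) = lim (\<lambda>n. \<Phi> t (s n t))"
    using lim by eventually_elim (metis limI isCont_tendsto_compose cont)
  ultimately show ?thesis by (intro bexI[where x = "\<lambda>t. lim (\<lambda>n. \<Phi> t (s n t))"])
qed

text \<open>Almost everywhere statements live on the open interval, gauge integrals on the closed
  one; the two endpoints are simply added to the exceptional set.\<close>

lemma AE_lebesgue_on_negligible:
  assumes "AE t in lebesgue_on {0<..<T::real}. P t"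
  shows "negligible {t \<in> {0..T}. \<not> P t}"
proof -
  have "AE t in lebesgue. t \<in> {0<..<T} \<longrightarrow> P t"
    using assms by (simp add: AE_restrict_space_iff)
  then have "negligible {t. \<not> (t \<in> {0<..<T} \<longrightarrow> P t)}"
    by (simp add: negligible_iff_null_sets completion.AE_iff_null_sets)
  then have "negligible ({t. \<not> (t \<in> {0<..<T} \<longrightarrow> P t)} \<union> {0, T})"
    by (intro negligible_Un) auto
  then show ?thesis by (rule negligible_subset) auto
qed

lemma has_integral_le_AE:
  fixes f g :: "'n::euclidean_space \<Rightarrow> real"
  assumes N: "negligible N" and "(f has_integral i) S" "(g has_integral j) S"
    and "\<And>t. t \<in> S - N \<Longrightarrow> f t \<le> g t"
  shows "i \<le> j"
proof (rule has_integral_le)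
  show "((\<lambda>t. if t \<in> N then g t else f t) has_integral i) S"
    by (rule has_integral_spike[OF N _ assms(2)]) auto
qed (use assms in auto)

text \<open>On an interval of finite measure, bounding \<open>norm (g t)\<close> by 1 plus its
  square makes the measurable version \<open>w\<close> integrable. \<open>p\<close> inherits this,
  since it differs from \<open>w\<close> only on a negligible set.\<close>

lemma L2_fun_AE_integrable:
  fixes g :: "real \<Rightarrow> 'a::real_normed_vector" and w :: "real \<Rightarrow> real"
  assumes g: "L2_fun T g" and w: "w \<in> borel_measurable (lebesgue_on {0<..<T})"
    and ae: "AE t in lebesgue_on {0<..<T}. p t = w t"
    and bound: "\<And>t. t \<in> {0<..<T} \<Longrightarrow> \<bar>p t\<bar> \<le> C * norm (g t)"
  shows "p integrable_on {0..T}"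
proof -
  let ?M = "lebesgue_on {0<..<T}"
  have C: "norm (w t) \<le> \<bar>C\<bar> * (1 + (norm (g t))\<^sup>2)" if "p t = w t" "t \<in> space ?M" for t
  proof -
    have "2 * norm (g t) \<le> (norm (g t))\<^sup>2 + 1"
      using zero_le_power2[of "norm (g t) - 1"] by (simp add: power2_diff)
    then have "norm (g t) \<le> 1 + (norm (g t))\<^sup>2"
      using norm_ge_zero[of "g t"] by linarith
    then have "C * norm (g t) \<le> \<bar>C\<bar> * (1 + (norm (g t))\<^sup>2)"
      by (intro mult_mono) auto
    with bound[of t] that show ?thesis by auto
  qed
  have "(\<integral>\<^sup>+t. ennreal (norm (w t)) \<partial>?M) \<le> (\<integral>\<^sup>+t. ennreal \<bar>C\<bar> * (1 + ennreal ((norm (g t))\<^sup>2)) \<partial>?M)"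
  proof (rule nn_integral_mono_AE)
    show "AE t in ?M. ennreal (norm (w t)) \<le> ennreal \<bar>C\<bar> * (1 + ennreal ((norm (g t))\<^sup>2))"
      using ae AE_space
    proof eventually_elim
      case (elim t)
      have "ennreal \<bar>C\<bar> * (1 + ennreal ((norm (g t))\<^sup>2)) = ennreal (\<bar>C\<bar> * (1 + (norm (g t))\<^sup>2))"
        by (simp add: ennreal_mult flip: ennreal_1 ennreal_plus)
      then show ?case using C[OF elim] by (simp add: ennreal_leI)
    qed
  qed
  \<comment> \<open>Splitting the integral of the sum requires a measurable integrand, so the
    squared norm is exchanged for a measurable version and back.\<close>
  also obtain w2 where w2: "w2 \<in> borel_measurable ?M" "AE t in ?M. (norm (g t))\<^sup>2 = w2 t"
    using strongly_measurable_Caratheodory[of ?M g "\<lambda>_ c. (norm c)\<^sup>2"] g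
    by (auto simp: L2_fun_def)
  have "(\<integral>\<^sup>+t. ennreal \<bar>C\<bar> * (1 + ennreal ((norm (g t))\<^sup>2)) \<partial>?M) =
        (\<integral>\<^sup>+t. ennreal \<bar>C\<bar> * (1 + ennreal (w2 t)) \<partial>?M)"
    using w2(2) by (intro nn_integral_cong_AE) auto
  also have "\<dots> = ennreal \<bar>C\<bar> * ((\<integral>\<^sup>+t. 1 \<partial>?M) + (\<integral>\<^sup>+t. ennreal (w2 t) \<partial>?M))"
    using w2(1) by (simp add: nn_integral_cmult nn_integral_add)
  also have "(\<integral>\<^sup>+t. ennreal (w2 t) \<partial>?M) = (\<integral>\<^sup>+t. ennreal ((norm (g t))\<^sup>2) \<partial>?M)"
    using w2(2) by (intro nn_integral_cong_AE) auto
  also have "ennreal \<bar>C\<bar> * ((\<integral>\<^sup>+t. 1 \<partial>?M) + \<dots>) < \<infinity>"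
    using g emeasure_bounded_finite[of "{0<..<T}"] by (auto simp: L2_fun_def ennreal_mult_less_top emeasure_restrict_space)
  finally have "integrable ?M w"
    using w by (simp add: integrable_iff_bounded)
  then have "w integrable_on {0<..<T}"
    by (intro integrable_on_lebesgue_on) auto
  then have "w integrable_on {0..T}" by (simp add: integrable_on_Icc_iff_Ioo)
  then show ?thesis
    by (rule integrable_spike[OF _ AE_lebesgue_on_negligible[OF ae]]) auto
qed

lemma L2_fun_norm_integrable:
  assumes "L2_fun T g"
  shows "(\<lambda>t. norm (g t)) integrable_on {0..T}"
proof -
  obtain w where "w \<in> borel_measurable (lebesgue_on {0<..<T})"
      "AE t in lebesgue_on {0<..<T}. norm (g t) = w t"
    using strongly_measurable_Caratheodory[of "lebesgue_on {0<..<T}" g "\<lambda>_ c. norm c"] assms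
    by (auto simp: L2_fun_def)
  then show ?thesis
    by (rule L2_fun_AE_integrable[OF assms, where C = 1]) auto
qed

lemma L2_fun_inner_integrable:
  fixes g z :: "real \<Rightarrow> 'a::real_inner"
  assumes g: "L2_fun T g" and z: "continuous_on {0..T} z"
  shows "(\<lambda>t. g t \<bullet> z t) integrable_on {0..T}"
proof -
  have "(\<lambda>t. c \<bullet> z t) \<in> borel_measurable (lebesgue_on {0<..<T})" for c
    by (rule continuous_imp_measurable_on_sets_lebesgue)
       (auto intro!: continuous_intros continuous_on_subset[OF z])
  then obtain w where w: "w \<in> borel_measurable (lebesgue_on {0<..<T})"
      "AE t in lebesgue_on {0<..<T}. g t \<bullet> z t = w t"
    using strongly_measurable_Caratheodory[of "lebesgue_on {0<..<T}" g "\<lambda>t c. c \<bullet> z t"] g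
    by (auto simp: L2_fun_def)
  have "bounded (z ` {0..T})"
    using compact_continuous_image[OF z] compact_imp_bounded by auto
  then obtain C where C: "\<And>t. t \<in> {0..T} \<Longrightarrow> norm (z t) \<le> C"
    unfolding bounded_iff by blast
  show ?thesis
  proof (rule L2_fun_AE_integrable[OF g w])
    fix t assume "t \<in> {0<..<T}"
    then have "norm (g t) * norm (z t) \<le> norm (g t) * C"
      by (intro mult_left_mono C) auto
    then show "\<bar>g t \<bullet> z t\<bar> \<le> C * norm (g t)"
      using Cauchy_Schwarz_ineq2[of "g t" "z t"] by (simp add: mult.commute)
  qed
qed

section \<open>Weak derivatives as Pettis derivatives\<close>

text \<open>Difference of two unit ramps, over [a, a + \<epsilon>] and [b, b + \<epsilon>],
  approximating the indicator of (a, b]. Both ramps run to the right of their nodes, so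
  \<open>0 < a\<close> and \<open>b + \<epsilon> < T\<close> keep the support inside (0, T).\<close>

definition cutoff :: "real \<Rightarrow> real \<Rightarrow> real \<Rightarrow> real \<Rightarrow> real" where
  "cutoff \<epsilon> a b t = smooth_step (1 / \<epsilon> * t + - a / \<epsilon>) - smooth_step (1 / \<epsilon> * t + - b / \<epsilon>)"

lemma cutoff_in_test_funs:
  assumes "0 < a" "a \<le> b" "\<epsilon> > 0" "b + \<epsilon> < T"
  shows "cutoff \<epsilon> a b \<in> test_funs T"
proof -
  have "smooth_fun (cutoff \<epsilon> a b)"
    unfolding cutoff_def[abs_def]
    by (intro smooth_fun_diff smooth_fun.affine smooth_fun_smooth_step)
  moreover have "cutoff \<epsilon> a b t = 0" if "t \<notin> {a..b + \<epsilon>}" for t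
  proof -
    consider "t < a" | "t > b + \<epsilon>" using \<open>t \<notin> {a..b + \<epsilon>}\<close> by fastforce
    then show ?thesis
    proof cases
      case 1
      with assms show ?thesis by (simp add: cutoff_def smooth_step_eq_0 field_simps)
    next
      case 2
      with assms show ?thesis by (simp add: cutoff_def smooth_step_eq_1 field_simps)
    qed
  qed
  ultimately show ?thesis
    using assms smooth_fun_iterated_deriv by (fastforce simp: test_funs_def)
qed

lemma cutoff_bound: "\<bar>cutoff \<epsilon> a b t\<bar> \<le> 1"
  using smooth_step_bounds[of "1 / \<epsilon> * t + - a / \<epsilon>"] smooth_step_bounds[of "1 / \<epsilon> * t + - b / \<epsilon>"]
  by (simp add: cutoff_def)

lemma scaled_step_has_real_derivative:
  "((\<lambda>t. smooth_step (1 / \<epsilon> * t + - a / \<epsilon>)) has_real_derivative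
     deriv smooth_step (1 / \<epsilon> * t + - a / \<epsilon>) / \<epsilon>) (at t)"
proof -
  have "((\<lambda>t. 1 / \<epsilon> * t + - a / \<epsilon>) has_real_derivative 1 / \<epsilon>) (at t)"
    by (rule DERIV_cong[OF DERIV_add[OF DERIV_cmult[OF DERIV_ident] DERIV_const]]) simp
  from DERIV_chain2[OF smooth_fun_has_real_derivative[OF smooth_fun_smooth_step] this]
  show ?thesis by simp
qed

lemma deriv_cutoff:
  "deriv (cutoff \<epsilon> a b) t =
    deriv smooth_step (1 / \<epsilon> * t + - a / \<epsilon>) / \<epsilon> - deriv smooth_step (1 / \<epsilon> * t + - b / \<epsilon>) / \<epsilon>"
  unfolding cutoff_def[abs_def]
  by (intro DERIV_imp_deriv DERIV_diff scaled_step_has_real_derivative)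

lemma deriv_scaled_step_mass:
  assumes "0 \<le> a" "\<epsilon> > 0" "a + \<epsilon> \<le> T"
  shows "((\<lambda>t. deriv smooth_step (1 / \<epsilon> * t + - a / \<epsilon>) / \<epsilon>) has_integral 1) {0..T}"
proof -
  have "((\<lambda>t. deriv smooth_step (1 / \<epsilon> * t + - a / \<epsilon>) / \<epsilon>) has_integral
      smooth_step (1 / \<epsilon> * T + - a / \<epsilon>) - smooth_step (1 / \<epsilon> * 0 + - a / \<epsilon>)) {0..T}"
    using assms
    by (intro fundamental_theorem_of_calculus, simp)
       (unfold has_real_derivative_iff_has_vector_derivative[symmetric],
        rule DERIV_subset[OF scaled_step_has_real_derivative subset_UNIV])
  moreover have "smooth_step (1 / \<epsilon> * T + - a / \<epsilon>) = 1" "smooth_step (1 / \<epsilon> * 0 + - a / \<epsilon>) = 0"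
    using assms by (auto intro!: smooth_step_eq_1 smooth_step_eq_0 simp: field_simps)
  ultimately show ?thesis by simp
qed

lemma deriv_smooth_step_eq_0:
  assumes "t < 0 \<or> t > 1"
  shows "deriv smooth_step t = 0"
proof -
  have "(smooth_step has_real_derivative 0) (at t)"
  proof (cases "t < 0")
    case True
    show ?thesis
      by (rule has_field_derivative_transform_within_open[where S="{..<0}" and f="\<lambda>_. 0"])
         (use True in \<open>auto simp: smooth_step_eq_0\<close>)
  next
    case False
    show ?thesis
      by (rule has_field_derivative_transform_within_open[where S="{1<..}" and f="\<lambda>_. 1"])
         (use False assms in \<open>auto simp: smooth_step_eq_1\<close>)
  qed
  then show ?thesis by (rule DERIV_imp_deriv)
qed

text \<open>The derivative of the cutoff is the difference of two probability densities supported in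
  [a, a + \<epsilon>] and [b, b + \<epsilon>]. Integrating \<open>u\<close> against them gives
  averages of \<open>u\<close> near \<open>a\<close> and \<open>b\<close>, each off by at most
  \<omega>.\<close>

lemma deriv_cutoff_integral_approx:
  fixes u :: "real \<Rightarrow> real"
  assumes ab: "0 < a" "a < b" "\<epsilon> > 0" "b + \<epsilon> < T"
    and I: "((\<lambda>t. deriv (cutoff \<epsilon> a b) t * u t) has_integral I) {0..T}"
    and osc: "\<And>t. t \<in> {a..a + \<epsilon>} \<Longrightarrow> \<bar>u t - u a\<bar> \<le> \<omega>" "\<And>t. t \<in> {b..b + \<epsilon>} \<Longrightarrow> \<bar>u t - u b\<bar> \<le> \<omega>"
  shows "\<bar>I - (u a - u b)\<bar> \<le> 2 * \<omega>"
proof -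
  define p where "p c t = deriv smooth_step (1 / \<epsilon> * t + - c / \<epsilon>) / \<epsilon>" for c t
  have mass: "(p a has_integral 1) {0..T}" "(p b has_integral 1) {0..T}"
    unfolding p_def by (rule deriv_scaled_step_mass; use ab in linarith)+
  have pn: "p c t \<ge> 0" for c t
    unfolding p_def using ab deriv_smooth_step_nonneg by simp
  have p0: "p c t = 0" if "t \<notin> {c..c + \<epsilon>}" for c t
    unfolding p_def using that ab by (subst deriv_smooth_step_eq_0) (auto simp: field_simps)
  have diff: "((\<lambda>t. deriv (cutoff \<epsilon> a b) t * u t - (p a t * u a - p b t * u b)) has_integral
      I - (1 * u a - 1 * u b)) {0..T}"
    by (intro has_integral_diff I has_integral_mult_left mass)
  have major: "((\<lambda>t. p a t * \<omega> + p b t * \<omega>) has_integral 1 * \<omega> + 1 * \<omega>) {0..T}"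
    by (intro has_integral_add has_integral_mult_left mass)
  have pt: "\<bar>deriv (cutoff \<epsilon> a b) t * u t - (p a t * u a - p b t * u b)\<bar> \<le> p a t * \<omega> + p b t * \<omega>" for t
  proof -
    have "\<bar>p c t * (u t - u c)\<bar> \<le> p c t * \<omega>" if "c = a \<or> c = b" for c
      using osc[of t] that pn[of c t] p0[of t c]
      by (cases "t \<in> {c..c + \<epsilon>}") (auto simp: abs_mult intro!: mult_left_mono)
    from this[of a] this[of b]
    have "\<bar>p a t * (u t - u a) - p b t * (u t - u b)\<bar> \<le> p a t * \<omega> + p b t * \<omega>" by simp
    moreover have cut: "deriv (cutoff \<epsilon> a b) t = p a t - p b t"
      by (simp add: deriv_cutoff p_def)
    have "deriv (cutoff \<epsilon> a b) t * u t - (p a t * u a - p b t * u b) =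
        p a t * (u t - u a) - p b t * (u t - u b)"
      unfolding cut by (simp add: algebra_simps)
    ultimately show ?thesis by simp
  qed
  have "I - (u a - u b) \<le> 2 * \<omega>"
    using has_integral_le[OF diff major] pt by (simp add: abs_le_iff)
  moreover have "- (I - (u a - u b)) \<le> 2 * \<omega>"
    using has_integral_le[OF has_integral_neg[OF diff] major] pt by (simp add: abs_le_iff)
  ultimately show ?thesis by linarith
qed

lemma cutoff_tendsto_indicator:
  assumes "a \<le> b"
  shows "(\<lambda>n. cutoff (1 / real (Suc n)) a b t) \<longlonglongrightarrow> indicator {a<..b} t"
proof -
  have step: "(\<lambda>n. smooth_step (1 / (1 / real (Suc n)) * t + - c / (1 / real (Suc n)))) \<longlonglongrightarrow>
      (if t \<le> c then 0 else 1)" for c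
  proof (cases "t \<le> c")
    case True
    then have "smooth_step (1 / (1 / real (Suc n)) * t + - c / (1 / real (Suc n))) = 0" for n
      by (intro smooth_step_eq_0) (simp add: mult_left_mono flip: left_diff_distrib right_diff_distrib)
    with True show ?thesis by simp
  next
    case False
    have "filterlim (\<lambda>n. real (Suc n) * (t - c)) at_top sequentially"
      using False by (intro filterlim_at_top_mult_tendsto_pos[OF tendsto_const] filterlim_compose[OF filterlim_real_sequentially filterlim_Suc]) auto
    then have "eventually (\<lambda>n. real (Suc n) * (t - c) \<ge> 1) sequentially"
      by (simp add: filterlim_at_top)
    then have "eventually (\<lambda>n. smooth_step (1 / (1 / real (Suc n)) * t + - c / (1 / real (Suc n))) = 1) sequentially"
      by eventually_elim (auto intro!: smooth_step_eq_1 simp: algebra_simps)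
    with False show ?thesis by (simp add: tendsto_eventually)
  qed
  have "(\<lambda>n. cutoff (1 / real (Suc n)) a b t) \<longlonglongrightarrow> (if t \<le> a then 0 else 1) - (if t \<le> b then 0 else 1)"
    unfolding cutoff_def by (intro tendsto_diff step)
  moreover have "(if t \<le> a then 0 else 1) - (if t \<le> b then 0 else 1) = (indicator {a<..b} t :: real)"
    using assms by (auto simp: indicator_def)
  ultimately show ?thesis by simp
qed

text \<open>For cutoffs of shrinking width, the integral with \<open>u\<close> converges by
  continuity of \<open>u\<close> at the two nodes, and the integral with \<open>g\<close> by
  dominated convergence with majorant \<open>\<bar>g t\<bar>\<close>. Both limits are limits of the
  same sequence \<open>J\<close>.\<close>

lemma weak_deriv_increment_interior:
  fixes u g :: "real \<Rightarrow> real"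
  assumes ab: "0 < a" "a < b" "b < T"
    and u: "continuous_on {0..T} u"
    and g: "(\<lambda>t. \<bar>g t\<bar>) integrable_on {0..T}" "g integrable_on {0..T}"
    and weak: "\<And>\<psi>. \<psi> \<in> test_funs T \<Longrightarrow> \<exists>J. ((\<lambda>t. deriv \<psi> t * u t) has_integral - J) {0..T} \<and>
      ((\<lambda>t. \<psi> t * g t) has_integral J) {0..T}"
  shows "integral {a..b} g = u b - u a"
proof -
  obtain N :: nat where N: "1 / real (Suc N) < T - b"
    using ab reals_Archimedean[of "T - b"] by (auto simp: inverse_eq_divide)
  define \<epsilon> where "\<epsilon> n = 1 / real (Suc (n + N))" for n
  have \<epsilon>: "\<epsilon> n > 0" "b + \<epsilon> n < T" for n
  proof -
    show "\<epsilon> n > 0" by (simp add: \<epsilon>_def)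
    have "\<epsilon> n \<le> 1 / real (Suc N)" unfolding \<epsilon>_def by (intro divide_left_mono) auto
    then show "b + \<epsilon> n < T" using N by simp
  qed
  have "\<forall>n. \<exists>J. ((\<lambda>t. deriv (cutoff (\<epsilon> n) a b) t * u t) has_integral - J) {0..T} \<and>
      ((\<lambda>t. cutoff (\<epsilon> n) a b t * g t) has_integral J) {0..T}"
    using ab \<epsilon> by (intro allI weak cutoff_in_test_funs) auto
  then obtain J where J: "\<And>n. ((\<lambda>t. deriv (cutoff (\<epsilon> n) a b) t * u t) has_integral - J n) {0..T}"
      "\<And>n. ((\<lambda>t. cutoff (\<epsilon> n) a b t * g t) has_integral J n) {0..T}"
    by metis
  have eps0: "\<epsilon> \<longlonglongrightarrow> 0"
    unfolding \<epsilon>_def using LIMSEQ_ignore_initial_segment[OF LIMSEQ_inverse_real_of_nat, of N]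
    by (simp add: inverse_eq_divide)
  have "(\<lambda>n. integral {0..T} (\<lambda>t. cutoff (\<epsilon> n) a b t * g t)) \<longlonglongrightarrow>
      integral {0..T} (\<lambda>t. indicator {a<..b} t * g t)"
  proof (rule dominated_convergence(2)[OF _ g(1)])
    show "(\<lambda>t. cutoff (\<epsilon> n) a b t * g t) integrable_on {0..T}" for n
      using J(2) by blast
    show "norm (cutoff (\<epsilon> n) a b t * g t) \<le> \<bar>g t\<bar>" for n t
      using mult_right_mono[OF cutoff_bound[of "\<epsilon> n" a b t], of "\<bar>g t\<bar>"] by (simp add: abs_mult)
    show "(\<lambda>n. cutoff (\<epsilon> n) a b t * g t) \<longlonglongrightarrow> indicator {a<..b} t * g t" for t
      unfolding \<epsilon>_def using LIMSEQ_ignore_initial_segment[OF cutoff_tendsto_indicator[of a b t], of N] ab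
      by (intro tendsto_mult tendsto_const) auto
  qed
  moreover have "integral {0..T} (\<lambda>t. indicator {a<..b} t * g t) = integral {a..b} g"
  proof -
    have "((\<lambda>t. if t \<in> {a..b} then g t else 0) has_integral integral {a..b} g) {0..T}"
      using ab by (subst has_integral_restrict)
         (auto intro!: integrable_integral integrable_on_subinterval[OF g(2)])
    then have "((\<lambda>t. indicator {a<..b} t * g t) has_integral integral {a..b} g) {0..T}"
      by (rule has_integral_spike[OF negligible_sing[of a], rotated]) (auto simp: indicator_def)
    then show ?thesis by (rule integral_unique)
  qed
  ultimately have lim1: "J \<longlonglongrightarrow> integral {a..b} g"
    using J(2)[THEN integral_unique] by simp
  have "J \<longlonglongrightarrow> u b - u a"
  proof (rule LIMSEQ_I)
    fix r :: real assume r: "r > 0"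
    have "\<exists>d>0. \<forall>t\<in>{0..T}. dist t c < d \<longrightarrow> dist (u t) (u c) < r / 3" if "c \<in> {0..T}" for c
      using u r that unfolding continuous_on_iff by (metis zero_less_divide_iff zero_less_numeral)
    from this[of a] this[of b] ab obtain d1 d2 where
        d: "d1 > 0" "d2 > 0"
          "\<And>t. t \<in> {0..T} \<Longrightarrow> dist t a < d1 \<Longrightarrow> dist (u t) (u a) < r / 3"
          "\<And>t. t \<in> {0..T} \<Longrightarrow> dist t b < d2 \<Longrightarrow> dist (u t) (u b) < r / 3"
      by fastforce
    have "eventually (\<lambda>n. \<epsilon> n < min d1 d2) sequentially"
      using eps0 d(1,2) by (intro order_tendstoD) auto
    then obtain n0 where n0: "\<And>n. n \<ge> n0 \<Longrightarrow> \<epsilon> n < min d1 d2"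
      by (auto simp: eventually_sequentially)
    have "\<bar>J n - (u b - u a)\<bar> < r" if "n \<ge> n0" for n
    proof -
      have "\<bar>- J n - (u a - u b)\<bar> \<le> 2 * (r / 3)"
      proof (rule deriv_cutoff_integral_approx[OF ab(1,2) \<epsilon>[of n] J(1)])
        fix t assume "t \<in> {a..a + \<epsilon> n}"
        then show "\<bar>u t - u a\<bar> \<le> r / 3"
          using d(3)[of t] n0[OF that] \<epsilon>[of n] ab by (auto simp: dist_real_def)
      next
        fix t assume "t \<in> {b..b + \<epsilon> n}"
        then show "\<bar>u t - u b\<bar> \<le> r / 3"
          using d(4)[of t] n0[OF that] \<epsilon>[of n] ab by (auto simp: dist_real_def)
      qed
      then show ?thesis using r by linarith
    qed
    then show "\<exists>n0. \<forall>n\<ge>n0. norm (J n - (u b - u a)) < r" by auto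
  qed
  with lim1 show ?thesis by (rule LIMSEQ_unique)
qed

text \<open>Test functions vanish near the endpoints, so they only show that \<open>u\<close> minus
  the indefinite integral of \<open>g\<close> is constant on the open interval; continuity carries
  the constant to 0 and \<open>T\<close>.\<close>

lemma weak_deriv_increment:
  fixes u g :: "real \<Rightarrow> real"
  assumes ab: "0 \<le> a" "a \<le> b" "b \<le> T"
    and u: "continuous_on {0..T} u"
    and g: "(\<lambda>t. \<bar>g t\<bar>) integrable_on {0..T}" "g integrable_on {0..T}"
    and weak: "\<And>\<psi>. \<psi> \<in> test_funs T \<Longrightarrow> \<exists>J. ((\<lambda>t. deriv \<psi> t * u t) has_integral - J) {0..T} \<and>
      ((\<lambda>t. \<psi> t * g t) has_integral J) {0..T}"
  shows "(g has_integral u b - u a) {a..b}"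
proof (cases "T > 0")
  case True
  define H where "H t = u t - integral {0..t} g" for t
  have H_diff: "H t - H s = u t - u s - integral {s..t} g" if "0 \<le> s" "s \<le> t" "t \<le> T" for s t
    using Henstock_Kurzweil_Integration.integral_combine[of 0 s t g] that
      integrable_on_subinterval[OF g(2), of 0 t]
    by (simp add: H_def)
  have inner: "H s = H t" if "0 < s" "s < t" "t < T" for s t
    using H_diff[of s t] weak_deriv_increment_interior[OF that u g weak] that by simp
  have const: "H t = H (T / 2)" if "t \<in> {0<..<T}" for t
  proof (cases t "T / 2" rule: linorder_cases)
    case less
    with that True show ?thesis by (intro inner) auto
  next
    case greater
    with that True show ?thesis by (intro inner[symmetric]) auto
  next
    case equal
    then show ?thesis by (rule arg_cong)
  qed
  have H: "continuous_on {0..T} H"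
    unfolding H_def by (intro continuous_intros u indefinite_integral_continuous_1 g)
  have "H t = H (T / 2)" if "t \<in> {0..T}" for t
  proof (rule continuous_constant_on_closure[OF _ const])
    show "continuous_on (closure {0<..<T}) H" "t \<in> closure {0<..<T}"
      using H True that by auto
  qed
  from this[of a] this[of b] have "H b = H a" using ab by auto
  then have "integral {a..b} g = u b - u a" using H_diff[of a b] ab by simp
  moreover have "g integrable_on {a..b}"
    using ab by (intro integrable_on_subinterval[OF g(2)]) auto
  ultimately show ?thesis by (metis integrable_integral)
next
  case False
  then have "a = b" using ab by simp
  then show ?thesis by (simp add: has_integral_refl)
qed

text \<open>The functional \<open>\<lambda>y. y \<bullet> e\<close> is bounded and linear, so it
  passes through both integrals in the definition of the weak derivative and leaves a scalar
  problem. That \<open>e\<close> is arbitrary makes \<open>g\<close> a Pettis derivative of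
  \<open>u\<close>.\<close>

lemma W12_deriv_increment:
  fixes u g :: "real \<Rightarrow> 'a::real_inner"
  assumes W: "W12_deriv T u g" and st: "0 \<le> s" "s \<le> t" "t \<le> T"
  shows "((\<lambda>\<tau>. g \<tau> \<bullet> e) has_integral (u t - u s) \<bullet> e) {s..t}"
proof -
  have u: "continuous_on {0..T} u" and g: "L2_fun T g" and weak: "weak_deriv T u g"
    using W by (auto simp: W12_deriv_def)
  have gi: "(\<lambda>t. g t \<bullet> e) integrable_on {0..T}"
    by (rule L2_fun_inner_integrable[OF g]) auto
  have "(\<lambda>t. g t \<bullet> e) absolutely_integrable_on {0..T}"
  proof (rule absolutely_integrable_integrable_bound[OF _ gi])
    show "(\<lambda>t. norm (g t) * norm e) integrable_on {0..T}"
      using L2_fun_norm_integrable[OF g] by (rule integrable_on_mult_left)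
  qed (simp add: Cauchy_Schwarz_ineq2)
  then have gabs: "(\<lambda>t. \<bar>g t \<bullet> e\<bar>) integrable_on {0..T}"
    by (simp add: absolutely_integrable_on_def)
  have "((\<lambda>\<tau>. g \<tau> \<bullet> e) has_integral u t \<bullet> e - u s \<bullet> e) {s..t}"
  proof (rule weak_deriv_increment[OF st _ gabs gi])
    show "continuous_on {0..T} (\<lambda>t. u t \<bullet> e)" by (intro continuous_intros u)
    fix \<psi> assume "\<psi> \<in> test_funs T"
    then obtain J where J: "((\<lambda>t. deriv \<psi> t *\<^sub>R u t) has_integral - J) {0..T}"
        "((\<lambda>t. \<psi> t *\<^sub>R g t) has_integral J) {0..T}"
      using weak unfolding weak_deriv_def by blast
    show "\<exists>J. ((\<lambda>t. deriv \<psi> t * (u t \<bullet> e)) has_integral - J) {0..T} \<and>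
        ((\<lambda>t. \<psi> t * (g t \<bullet> e)) has_integral J) {0..T}"
      using J[THEN has_integral_linear[OF _ bounded_linear_inner_left[of e]]]
      by (intro exI[of _ "J \<bullet> e"]) (simp add: o_def)
  qed
  then show ?thesis by (simp add: inner_diff_left)
qed

section \<open>Energy identity and Gronwall inequality\<close>

text \<open>The hypothesis on \<open>z\<close> says that \<open>z\<close> is an indefinite Pettis integral of \<open>dz\<close>, so no
  differentiability of \<open>z\<close> is needed: on a short interval \<open>[s, t]\<close> the difference of squares
  \<open>(z t - z s) \<bullet> (z t + z s)\<close> is the integral of \<open>2 dz \<bullet> z\<close> up to a small multiple of
  \<open>\<integral> m\<close>, and these local errors add up.\<close>

lemma has_integral_inner_indefinite:
  fixes z dz :: "real \<Rightarrow> 'a::real_inner"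
  assumes ab: "a \<le> b" and z: "continuous_on {a..b} z"
    and dz: "\<And>s t e. a \<le> s \<Longrightarrow> s \<le> t \<Longrightarrow> t \<le> b \<Longrightarrow>
      ((\<lambda>\<tau>. dz \<tau> \<bullet> e) has_integral (z t - z s) \<bullet> e) {s..t}"
    and m: "m integrable_on {a..b}" "\<And>t. t \<in> {a..b} \<Longrightarrow> norm (dz t) \<le> m t"
    and idz: "(\<lambda>t. dz t \<bullet> z t) integrable_on {a..b}"
  shows "((\<lambda>t. 2 * (dz t \<bullet> z t)) has_integral (norm (z b))\<^sup>2 - (norm (z a))\<^sup>2) {a..b}"
proof -
  define q where "q s t = (norm (z t))\<^sup>2 - (norm (z s))\<^sup>2 - 2 * integral {s..t} (\<lambda>\<tau>. dz \<tau> \<bullet> z \<tau>)" for s t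
  define N where "N s t = integral {s..t} m" for s t
  have Nadd: "N s t + N t u = N s u" if "a \<le> s" "s \<le> t" "t \<le> u" "u \<le> b" for s t u
    unfolding N_def using that
    by (intro Henstock_Kurzweil_Integration.integral_combine integrable_on_subinterval[OF m(1)]) auto
  have qadd: "q s t + q t u = q s u" if "a \<le> s" "s \<le> t" "t \<le> u" "u \<le> b" for s t u
  proof -
    have "integral {s..t} (\<lambda>\<tau>. dz \<tau> \<bullet> z \<tau>) + integral {t..u} (\<lambda>\<tau>. dz \<tau> \<bullet> z \<tau>)
        = integral {s..u} (\<lambda>\<tau>. dz \<tau> \<bullet> z \<tau>)"
      using that
      by (intro Henstock_Kurzweil_Integration.integral_combine integrable_on_subinterval[OF idz]) auto
    then show ?thesis unfolding q_def by (simp add: algebra_simps)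
  qed
  have loc: "\<bar>q s t\<bar> \<le> 2 * \<epsilon> * N s t"
    if st: "a \<le> s" "s \<le> t" "t \<le> b"
      and osc: "\<And>\<tau>. \<tau> \<in> {s..t} \<Longrightarrow> norm (z s - z \<tau>) \<le> \<epsilon> \<and> norm (z t - z \<tau>) \<le> \<epsilon>" for s t \<epsilon>
  proof -
    have i: "(\<lambda>\<tau>. dz \<tau> \<bullet> z \<tau>) integrable_on {s..t}"
      using st by (intro integrable_on_subinterval[OF idz]) auto
    have n: "m integrable_on {s..t}"
      using st by (intro integrable_on_subinterval[OF m(1)]) auto
    have "((\<lambda>\<tau>. dz \<tau> \<bullet> (z s + z t) - 2 * (dz \<tau> \<bullet> z \<tau>)) has_integral
        (z t - z s) \<bullet> (z s + z t) - 2 * integral {s..t} (\<lambda>\<tau>. dz \<tau> \<bullet> z \<tau>)) {s..t}"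
      by (intro has_integral_diff has_integral_mult_right integrable_integral dz st i)
    moreover have "(z t - z s) \<bullet> (z s + z t) = (norm (z t))\<^sup>2 - (norm (z s))\<^sup>2"
      by (simp add: power2_norm_eq_inner inner_simps inner_commute)
    ultimately have q: "((\<lambda>\<tau>. dz \<tau> \<bullet> (z s + z t) - 2 * (dz \<tau> \<bullet> z \<tau>)) has_integral q s t) {s..t}"
      by (simp add: q_def)
    have pt: "\<bar>dz \<tau> \<bullet> (z s + z t) - 2 * (dz \<tau> \<bullet> z \<tau>)\<bar> \<le> 2 * \<epsilon> * m \<tau>" if "\<tau> \<in> {s..t}" for \<tau>
    proof -
      have "dz \<tau> \<bullet> (z s + z t) - 2 * (dz \<tau> \<bullet> z \<tau>) = dz \<tau> \<bullet> ((z s - z \<tau>) + (z t - z \<tau>))"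
        by (simp add: inner_simps)
      also have "\<bar>\<dots>\<bar> \<le> norm (dz \<tau>) * norm ((z s - z \<tau>) + (z t - z \<tau>))"
        by (rule Cauchy_Schwarz_ineq2)
      also have "\<dots> \<le> norm (dz \<tau>) * (\<epsilon> + \<epsilon>)"
        using osc[OF that] by (intro mult_left_mono norm_triangle_le add_mono) auto
      also have "\<dots> \<le> m \<tau> * (\<epsilon> + \<epsilon>)"
        using m(2)[of \<tau>] order_trans[OF norm_ge_zero conjunct1[OF osc[OF that]]] st that
        by (intro mult_right_mono) auto
      finally show ?thesis by (simp add: algebra_simps)
    qed
    have N: "((\<lambda>\<tau>. 2 * \<epsilon> * m \<tau>) has_integral 2 * \<epsilon> * N s t) {s..t}"
      unfolding N_def by (intro has_integral_mult_right integrable_integral n)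
    have "q s t \<le> 2 * \<epsilon> * N s t"
      by (rule has_integral_le[OF q N]) (use pt in fastforce)
    moreover have "- q s t \<le> 2 * \<epsilon> * N s t"
      by (rule has_integral_le[OF has_integral_neg[OF q] N]) (use pt in fastforce)
    ultimately show ?thesis by linarith
  qed
  have small: "\<bar>q a b\<bar> \<le> 2 * \<epsilon> * N a b" if "\<epsilon> > 0" for \<epsilon>
  proof -
    have "a \<le> a \<and> b \<le> b \<longrightarrow> \<bar>q a b\<bar> \<le> 2 * \<epsilon> * N a b"
    \<comment> \<open>Bisection principle: a property of intervals that survives joining neighbours
      and holds on short intervals around every point holds on the whole interval. Joining works
      because \<open>q\<close> and \<open>N\<close> are additive.\<close>
    proof (rule Bolzano[OF ab, where P = "\<lambda>s t. a \<le> s \<and> t \<le> b \<longrightarrow> \<bar>q s t\<bar> \<le> 2 * \<epsilon> * N s t"], goal_cases)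
      case (1 s t u)
      show ?case
      proof
        assume *: "a \<le> s \<and> u \<le> b"
        have "\<bar>q s t\<bar> \<le> 2 * \<epsilon> * N s t" "\<bar>q t u\<bar> \<le> 2 * \<epsilon> * N t u"
          using 1 * by auto
        then have "\<bar>q s t + q t u\<bar> \<le> 2 * \<epsilon> * (N s t + N t u)"
          by (simp add: distrib_left)
        then show "\<bar>q s u\<bar> \<le> 2 * \<epsilon> * N s u"
          using 1 * by (simp add: qadd Nadd)
      qed
    next
      case (2 x)
      then have "x \<in> {a..b}" by simp
      with z \<open>\<epsilon> > 0\<close> obtain d where d: "d > 0"
        "\<And>y. y \<in> {a..b} \<Longrightarrow> dist y x < d \<Longrightarrow> dist (z y) (z x) < \<epsilon> / 2"
        unfolding continuous_on_iff by (metis half_gt_zero)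
      show ?case
      proof (intro exI[of _ d] conjI allI impI)
        fix s t assume st: "s \<le> x \<and> x \<le> t \<and> t - s < d" "a \<le> s \<and> t \<le> b"
        have near: "norm (z \<tau> - z x) < \<epsilon> / 2" if "\<tau> \<in> {s..t}" for \<tau>
          using d(2)[of \<tau>] st that by (auto simp: dist_norm)
        show "\<bar>q s t\<bar> \<le> 2 * \<epsilon> * N s t"
        proof (rule loc)
          fix \<tau> assume \<tau>: "\<tau> \<in> {s..t}"
          have "norm (z y - z \<tau>) \<le> \<epsilon>" if "y \<in> {s..t}" for y
            using near[OF \<tau>] near[OF that] norm_triangle_ineq4[of "z y - z x" "z \<tau> - z x"] by simp
          then show "norm (z s - z \<tau>) \<le> \<epsilon> \<and> norm (z t - z \<tau>) \<le> \<epsilon>" using st by auto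
        qed (use st in auto)
      qed fact
    qed
    then show ?thesis by simp
  qed
  have "\<bar>q a b\<bar> \<le> 0"
  proof (rule field_le_epsilon)
    fix e :: real assume e: "e > 0"
    have "N a b \<ge> 0" unfolding N_def by (intro integral_nonneg m(1)) (meson m(2) norm_ge_zero order_trans)
    \<comment> \<open>The \<open>+ 1\<close> keeps the divisor positive when
      \<open>N a b = 0\<close>.\<close>
    then have "2 * (e / (2 * (N a b + 1))) * N a b \<le> e"
      using e by (simp add: field_simps)
    with small[of "e / (2 * (N a b + 1))"] e \<open>N a b \<ge> 0\<close> show "\<bar>q a b\<bar> \<le> 0 + e"
      by (smt (verit) divide_pos_pos)
  qed
  then have "2 * integral {a..b} (\<lambda>t. dz t \<bullet> z t) = (norm (z b))\<^sup>2 - (norm (z a))\<^sup>2"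
    by (simp add: q_def)
  then show ?thesis
    using has_integral_mult_right[OF integrable_integral[OF idz], of 2] by simp
qed

text \<open>\<open>W\<close> is the right-hand side of the hypothesis times the integrating factor
  exp(-K (t - a)); the hypothesis makes \<open>W\<close> nonincreasing, and
  \<open>W a = A\<close>.\<close>

lemma gronwall_integral:
  fixes F :: "real \<Rightarrow> real"
  assumes ab: "a \<le> b" and F: "continuous_on {a..b} F" and K: "K \<ge> 0"
    and le: "\<And>t. t \<in> {a..b} \<Longrightarrow> F t \<le> A + K * integral {a..t} F"
  shows "F b \<le> exp (K * (b - a)) * A"
proof -
  define W where "W t = exp (- K * (t - a)) * (A + K * integral {a..t} F)" for t
  have W': "(W has_real_derivative exp (- K * (t - a)) * (K * F t - K * (A + K * integral {a..t} F)))
      (at t within {a..b})" if "t \<in> {a..b}" for t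
    unfolding W_def
    by (auto intro!: derivative_eq_intros integral_has_real_derivative[OF F that] simp: algebra_simps)
  have "W b \<le> W a"
  proof (rule DERIV_nonpos_imp_decreasing_open[OF ab])
    fix t assume t: "a < t" "t < b"
    then have "(W has_real_derivative exp (- K * (t - a)) * (K * F t - K * (A + K * integral {a..t} F))) (at t)"
      using W'[of t] by (simp add: at_within_Icc_at)
    moreover have "K * F t \<le> K * (A + K * integral {a..t} F)"
      using t by (intro mult_left_mono le K) auto
    ultimately show "\<exists>y. (W has_real_derivative y) (at t) \<and> y \<le> 0"
      by (intro exI conjI) (auto intro!: mult_nonneg_nonpos)
  next
    show "continuous_on {a..b} W"
      using W' by (intro DERIV_continuous_on) auto
  qed
  then have "exp (- K * (b - a)) * (A + K * integral {a..b} F) \<le> A"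
    by (simp add: W_def)
  then have "exp (K * (b - a)) * (exp (- K * (b - a)) * (A + K * integral {a..b} F)) \<le> exp (K * (b - a)) * A"
    by (intro mult_left_mono) auto
  also have "exp (K * (b - a)) * (exp (- K * (b - a)) * (A + K * integral {a..b} F)) = A + K * integral {a..b} F"
    by (simp add: mult.assoc[symmetric] flip: exp_add)
  finally show ?thesis using le[of b] ab by simp
qed

section \<open>Bounds for the discrete scheme\<close>

lemma subdiff_monotone:
  assumes \<phi>: "proper_ereal \<phi>" and \<xi>: "\<xi> \<in> subdiff \<phi> v" and \<eta>: "\<eta> \<in> subdiff \<phi> w"
  shows "(\<xi> - \<eta>) \<bullet> (v - w) \<ge> 0"
proof -
  \<comment> \<open>Properness makes \<phi> finite wherever a subgradient exists, so the two
    extended-real inequalities can be added and the values of \<phi> cancel.\<close>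
  have fin: "\<bar>\<phi> u\<bar> \<noteq> \<infinity>" if "\<zeta> \<in> subdiff \<phi> u" for \<zeta> u
  proof -
    obtain y where "\<phi> y \<noteq> \<infinity>" using \<phi> by (auto simp: proper_ereal_def)
    moreover have "\<phi> u + ereal (\<zeta> \<bullet> (y - u)) \<le> \<phi> y" using that by (simp add: subdiff_def)
    moreover have "\<phi> u \<noteq> -\<infinity>" using \<phi> by (simp add: proper_ereal_def)
    ultimately show ?thesis by auto
  qed
  have "\<phi> v + ereal (\<xi> \<bullet> (w - v)) \<le> \<phi> w" "\<phi> w + ereal (\<eta> \<bullet> (v - w)) \<le> \<phi> v"
    using \<xi> \<eta> by (simp_all add: subdiff_def)
  with fin[OF \<xi>] fin[OF \<eta>] have "\<xi> \<bullet> (w - v) + \<eta> \<bullet> (v - w) \<le> 0"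
    by (cases "\<phi> v"; cases "\<phi> w") auto
  then show ?thesis by (simp add: inner_simps)
qed

text \<open>When \<open>eq\<close> is paired with \<open>d\<close>, the damping and subgradient
  terms are nonnegative and drop out. Two comparisons use this: \<open>v\<close> is either the
  previous iterate or the initial velocity, where \<open>\<xi>0\<close> acts as the missing earlier
  subgradient.\<close>

lemma resolvent_increment_le:
  fixes d :: "'a::real_inner"
  assumes \<phi>: "proper_ereal \<phi>" and \<xi>: "\<xi> \<in> subdiff \<phi> w" and \<eta>: "\<eta> \<in> subdiff \<phi> v"
    and "h > 0" "\<gamma> \<ge> 0" and d: "w - v = h *\<^sub>R d" and eq: "d + (h * \<gamma>) *\<^sub>R d + (\<xi> - \<eta>) = p"
  shows "norm d \<le> norm p"
proof -
  have "0 \<le> h * ((\<xi> - \<eta>) \<bullet> d)"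
    using subdiff_monotone[OF \<phi> \<xi> \<eta>] d by simp
  then have mono: "0 \<le> (\<xi> - \<eta>) \<bullet> d" using \<open>h > 0\<close> by (simp add: zero_le_mult_iff)
  have "p \<bullet> d = (norm d)\<^sup>2 + h * \<gamma> * (norm d)\<^sup>2 + (\<xi> - \<eta>) \<bullet> d"
    unfolding eq[symmetric] by (simp add: inner_simps power2_norm_eq_inner)
  moreover have "h * \<gamma> * (norm d)\<^sup>2 \<ge> 0" using assms by simp
  ultimately have "norm d * norm d \<le> p \<bullet> d" using mono by (simp add: power2_eq_square)
  also have "\<dots> \<le> norm p * norm d" by (rule norm_cauchy_schwarz)
  finally show ?thesis by (cases "d = 0") auto
qed

lemma discrete_scheme_step:
  assumes "discrete_scheme \<phi> G \<gamma> \<beta> x0 v0 h xs vs" "h > 0"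
  shows "\<exists>\<xi>\<in>subdiff \<phi> (vs (Suc k)).
      (1 / h) *\<^sub>R (vs (Suc k) - vs k) = - (\<gamma> *\<^sub>R vs (Suc k)) - \<xi> - G (xs k + \<beta> *\<^sub>R vs k)"
    and "xs (Suc k) = xs k + h *\<^sub>R vs (Suc k)"
proof -
  obtain \<xi> where "\<xi> \<in> subdiff \<phi> (vs (Suc k))"
      "(1 / h) *\<^sub>R (vs (Suc k) - vs k) + \<gamma> *\<^sub>R vs (Suc k) + \<xi> + G (xs k + \<beta> *\<^sub>R vs k) = 0"
    using assms unfolding discrete_scheme_def by blast
  then show "\<exists>\<xi>\<in>subdiff \<phi> (vs (Suc k)).
      (1 / h) *\<^sub>R (vs (Suc k) - vs k) = - (\<gamma> *\<^sub>R vs (Suc k)) - \<xi> - G (xs k + \<beta> *\<^sub>R vs k)"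
    by (intro bexI[of _ \<xi>]) (simp add: algebra_simps eq_neg_iff_add_eq_0)
  have "(1 / h) *\<^sub>R (xs (Suc k) - xs k) = vs (Suc k)"
    using assms unfolding discrete_scheme_def by blast
  then have "h *\<^sub>R ((1 / h) *\<^sub>R (xs (Suc k) - xs k)) = h *\<^sub>R vs (Suc k)" by simp
  then show "xs (Suc k) = xs k + h *\<^sub>R vs (Suc k)"
    using assms(2) by (simp add: algebra_simps)
qed

text \<open>The quotients \<open>d k\<close> alone satisfy no closed recursion: between two steps
  the argument of \<open>G\<close> moves by
  \<open>h *\<^sub>R (vs (Suc k) + \<beta> *\<^sub>R d k)\<close>. Adding the norm of the velocity
  gives \<open>S k\<close>, which grows by at most the factor \<open>1 + 2 * B * h\<close> per
  step.\<close>

lemma discrete_scheme_bounds: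
  fixes G :: "'a::real_inner \<Rightarrow> 'a"
  assumes \<phi>: "proper_ereal \<phi>" and G: "L-lipschitz_on UNIV G"
    and \<gamma>: "\<gamma> \<ge> 0" and \<beta>: "\<beta> \<ge> 0" and v0: "\<xi>0 \<in> subdiff \<phi> v0"
    and scheme: "discrete_scheme \<phi> G \<gamma> \<beta> x0 v0 h xs vs" and h: "0 < h" "h \<le> 1"
    and D: "norm (\<gamma> *\<^sub>R v0 + \<xi>0 + G (x0 + \<beta> *\<^sub>R v0)) \<le> D"
  shows "norm ((1 / h) *\<^sub>R (vs (Suc k) - vs k)) + norm (vs (Suc k))
    \<le> exp (2 * (1 + L * (1 + \<beta>)) * (real k * h)) * (2 * D + norm v0)"
proof -
  define d where "d k = (1 / h) *\<^sub>R (vs (Suc k) - vs k)" for k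
  define S where "S k = norm (d k) + norm (vs (Suc k))" for k
  define B where "B = 1 + L * (1 + \<beta>)"
  have L: "L \<ge> 0" using G by (rule lipschitz_on_nonneg)
  have B1: "B \<ge> 1" using L \<beta> by (simp add: B_def)
  have init: "xs 0 = x0" "vs 0 = v0" using scheme by (auto simp: discrete_scheme_def)
  have vd: "vs (Suc k) - vs k = h *\<^sub>R d k" for k using h by (simp add: d_def)
  have vnorm: "norm (vs (Suc k)) \<le> norm (vs k) + h * norm (d k)" for k
    using vd[of k] h norm_triangle_ineq[of "vs k" "h *\<^sub>R d k"] by (simp add: algebra_simps)
  have d0: "norm (d 0) \<le> D"
  proof -
    obtain \<xi> where \<xi>: "\<xi> \<in> subdiff \<phi> (vs (Suc 0))"
        "d 0 = - (\<gamma> *\<^sub>R vs (Suc 0)) - \<xi> - G (xs 0 + \<beta> *\<^sub>R vs 0)"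
      using discrete_scheme_step(1)[OF scheme h(1), of 0] unfolding d_def by blast
    have vs1: "vs (Suc 0) = v0 + h *\<^sub>R d 0" using vd[of 0] init by (simp add: algebra_simps)
    have "d 0 + (h * \<gamma>) *\<^sub>R d 0 + (\<xi> - \<xi>0) = - (\<gamma> *\<^sub>R v0 + \<xi>0 + G (x0 + \<beta> *\<^sub>R v0))"
      using \<xi>(2)[unfolded vs1] init by (simp add: algebra_simps eq_neg_iff_add_eq_0)
    then show ?thesis
      using resolvent_increment_le[OF \<phi> \<xi>(1) v0 h(1) \<gamma>] vd[of 0] init D
      by (metis norm_minus_cancel order_trans)
  qed
  have dstep: "norm (d (Suc k)) \<le> norm (d k) + h * (B - 1) * S k" for k
  proof -
    obtain \<xi> where \<xi>: "\<xi> \<in> subdiff \<phi> (vs (Suc (Suc k)))"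
        "d (Suc k) = - (\<gamma> *\<^sub>R vs (Suc (Suc k))) - \<xi> - G (xs (Suc k) + \<beta> *\<^sub>R vs (Suc k))"
      using discrete_scheme_step(1)[OF scheme h(1), of "Suc k"] unfolding d_def by blast
    obtain \<eta> where \<eta>: "\<eta> \<in> subdiff \<phi> (vs (Suc k))"
        "d k = - (\<gamma> *\<^sub>R vs (Suc k)) - \<eta> - G (xs k + \<beta> *\<^sub>R vs k)"
      using discrete_scheme_step(1)[OF scheme h(1), of k] unfolding d_def by blast
    define p where "p = d k - (G (xs (Suc k) + \<beta> *\<^sub>R vs (Suc k)) - G (xs k + \<beta> *\<^sub>R vs k))"
    have vs: "vs (Suc (Suc k)) = vs (Suc k) + h *\<^sub>R d (Suc k)"
      using vd[of "Suc k"] by (simp add: algebra_simps)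
    have "d (Suc k) + (h * \<gamma>) *\<^sub>R d (Suc k) + (\<xi> - \<eta>) = p"
      unfolding p_def using \<xi>(2) \<eta>(2) vs by (simp add: algebra_simps)
    then have "norm (d (Suc k)) \<le> norm p"
      using resolvent_increment_le[OF \<phi> \<xi>(1) \<eta>(1) h(1) \<gamma>] vd[of "Suc k"] by simp
    also have "norm p \<le> norm (d k) + norm (G (xs (Suc k) + \<beta> *\<^sub>R vs (Suc k)) - G (xs k + \<beta> *\<^sub>R vs k))"
      unfolding p_def by (rule norm_triangle_ineq4)
    finally have "norm (d (Suc k)) \<le>
        norm (d k) + norm (G (xs (Suc k) + \<beta> *\<^sub>R vs (Suc k)) - G (xs k + \<beta> *\<^sub>R vs k))" .
    moreover have "norm (G (xs (Suc k) + \<beta> *\<^sub>R vs (Suc k)) - G (xs k + \<beta> *\<^sub>R vs k))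
        \<le> L * (h * ((1 + \<beta>) * S k))"
    proof -
      have "(xs (Suc k) + \<beta> *\<^sub>R vs (Suc k)) - (xs k + \<beta> *\<^sub>R vs k)
          = h *\<^sub>R vs (Suc k) + \<beta> *\<^sub>R (vs (Suc k) - vs k)"
        using discrete_scheme_step(2)[OF scheme h(1), of k] by (simp add: algebra_simps)
      also have "\<dots> = h *\<^sub>R (vs (Suc k) + \<beta> *\<^sub>R d k)"
        unfolding vd by (simp add: algebra_simps)
      finally have "norm ((xs (Suc k) + \<beta> *\<^sub>R vs (Suc k)) - (xs k + \<beta> *\<^sub>R vs k))
          = h * norm (vs (Suc k) + \<beta> *\<^sub>R d k)" using h by simp
      also have "norm (vs (Suc k) + \<beta> *\<^sub>R d k) \<le> norm (vs (Suc k)) + \<beta> * norm (d k)"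
        using \<beta> norm_triangle_ineq[of "vs (Suc k)" "\<beta> *\<^sub>R d k"] by simp
      also have "\<dots> \<le> (1 + \<beta>) * S k"
        using \<beta> by (simp add: S_def algebra_simps)
      finally have "norm ((xs (Suc k) + \<beta> *\<^sub>R vs (Suc k)) - (xs k + \<beta> *\<^sub>R vs k)) \<le> h * ((1 + \<beta>) * S k)"
        using h by simp
      then show ?thesis
        using lipschitz_onD[OF G, of "xs (Suc k) + \<beta> *\<^sub>R vs (Suc k)" "xs k + \<beta> *\<^sub>R vs k"]
          mult_left_mono[OF _ L] by (fastforce simp: dist_norm)
    qed
    ultimately show ?thesis by (simp add: B_def algebra_simps)
  qed
  have Sn: "S k \<ge> 0" for k by (simp add: S_def)
  have step: "S (Suc k) \<le> exp (2 * B * h) * S k" for k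
  proof -
    \<comment> \<open>The crude bound \<open>norm (d (Suc k)) \<le> B * S k\<close>, where
      \<open>h \<le> 1\<close> enters, is enough for the velocity update because a further factor
      \<open>h\<close> stands in front of it.\<close>
    have "h * (B - 1) * S k \<le> (B - 1) * S k"
      using h B1 Sn[of k] by (intro mult_right_mono mult_left_le_one_le) auto
    with dstep[of k] have "norm (d (Suc k)) \<le> S k + (B - 1) * S k"
      by (smt (verit) S_def norm_ge_zero)
    then have "h * norm (d (Suc k)) \<le> h * (B * S k)"
      using h by (intro mult_left_mono) (auto simp: algebra_simps)
    with vnorm[of "Suc k"] have "norm (vs (Suc (Suc k))) \<le> norm (vs (Suc k)) + h * (B * S k)" by linarith
    with dstep[of k] have "S (Suc k) \<le> S k + h * (B - 1) * S k + h * (B * S k)"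
      by (simp add: S_def)
    also have "\<dots> \<le> (1 + 2 * B * h) * S k"
      using h Sn[of k] by (simp add: algebra_simps)
    also have "\<dots> \<le> exp (2 * B * h) * S k"
      using Sn by (intro mult_right_mono exp_ge_add_one_self) auto
    finally show ?thesis .
  qed
  have "S k \<le> exp (2 * B * (real k * h)) * S 0"
  proof (induction k)
    case (Suc k)
    have "S (Suc k) \<le> exp (2 * B * h) * (exp (2 * B * (real k * h)) * S 0)"
      by (rule order_trans[OF step mult_left_mono[OF Suc]]) simp
    also have "\<dots> = exp (2 * B * (real (Suc k) * h)) * S 0"
    proof -
      have "exp (2 * B * h) * exp (2 * B * (real k * h)) = exp (2 * B * (real (Suc k) * h))"
        unfolding exp_add[symmetric] by (simp add: algebra_simps)
      then show ?thesis by (simp only: mult.assoc[symmetric])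
    qed
    finally show ?case .
  qed simp
  \<comment> \<open>One \<open>D\<close> bounds \<open>d 0\<close>, the other the change from
    \<open>v0\<close> to the first iterate, using \<open>h \<le> 1\<close>.\<close>
  also have "S 0 \<le> 2 * D + norm v0"
  proof -
    have "h * norm (d 0) \<le> norm (d 0)" using h by (intro mult_left_le_one_le) auto
    then show ?thesis using vnorm[of 0] d0 init by (simp add: S_def)
  qed
  finally show ?thesis by (simp add: S_def d_def B_def)
qed

section \<open>Error growth on one step\<close>

text \<open>\<open>c - du\<close> is the Pettis derivative of the affine function minus
  \<open>u\<close>, so the energy identity applies, with majorant
  \<open>norm c + norm (du \<tau>)\<close>. It serves for both components of the error on a
  cell.\<close>

lemma W12_affine_energy:
  fixes u du :: "real \<Rightarrow> 'a::real_inner"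
  assumes W: "W12_deriv T u du" and ab: "0 \<le> a" "a \<le> b" "b \<le> T"
  shows "((\<lambda>\<tau>. 2 * ((c - du \<tau>) \<bullet> (p + (\<tau> - a) *\<^sub>R c - u \<tau>))) has_integral
    (norm (p + (b - a) *\<^sub>R c - u b))\<^sup>2 - (norm (p - u a))\<^sup>2) {a..b}"
proof -
  define z where "z \<tau> = p + (\<tau> - a) *\<^sub>R c - u \<tau>" for \<tau>
  have u: "continuous_on {0..T} u" and du: "L2_fun T du"
    using W by (auto simp: W12_deriv_def)
  have zT: "continuous_on {0..T} z" unfolding z_def by (intro continuous_intros u)
  have z: "continuous_on {a..b} z" by (rule continuous_on_subset[OF zT]) (use ab in auto)
  have "((\<lambda>\<tau>. 2 * ((c - du \<tau>) \<bullet> z \<tau>)) has_integral (norm (z b))\<^sup>2 - (norm (z a))\<^sup>2) {a..b}"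
  proof (rule has_integral_inner_indefinite[OF ab(2) z, where m = "\<lambda>\<tau>. norm c + norm (du \<tau>)"])
    fix s t e assume st: "a \<le> s" "s \<le> t" "t \<le> b"
    have "((\<lambda>\<tau>. c \<bullet> e - du \<tau> \<bullet> e) has_integral (t - s) *\<^sub>R (c \<bullet> e) - (u t - u s) \<bullet> e) {s..t}"
      using st ab has_integral_const_real[of "c \<bullet> e" s t]
      by (intro has_integral_diff W12_deriv_increment[OF W]) auto
    moreover have "(t - s) *\<^sub>R (c \<bullet> e) - (u t - u s) \<bullet> e = (z t - z s) \<bullet> e"
      by (simp add: z_def inner_simps algebra_simps)
    ultimately show "((\<lambda>\<tau>. (c - du \<tau>) \<bullet> e) has_integral (z t - z s) \<bullet> e) {s..t}"
      by (simp add: inner_diff_left)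
  next
    have "(\<lambda>\<tau>. norm (du \<tau>)) integrable_on {a..b}"
      by (rule integrable_on_subinterval[OF L2_fun_norm_integrable[OF du]]) (use ab in auto)
    then show "(\<lambda>\<tau>. norm c + norm (du \<tau>)) integrable_on {a..b}"
      by (intro integrable_add integrable_const_ivl)
    have "(\<lambda>\<tau>. du \<tau> \<bullet> z \<tau>) integrable_on {a..b}"
      by (rule integrable_on_subinterval[OF L2_fun_inner_integrable[OF du zT]]) (use ab in auto)
    moreover have "(\<lambda>\<tau>. c \<bullet> z \<tau>) integrable_on {a..b}"
      by (intro integrable_continuous_interval continuous_intros z)
    ultimately show "(\<lambda>\<tau>. (c - du \<tau>) \<bullet> z \<tau>) integrable_on {a..b}"
      by (simp add: inner_diff_left integrable_diff)
  qed (rule norm_triangle_ineq4)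
  then show ?thesis by (simp add: z_def)
qed

text \<open>With B = 1 + L (1 + \<beta>), this single constant dominates the factor 6 B of the
  squared errors and, up to the factor \<open>1 + D\<close>, the coefficient
  \<open>6 * B * M\<^sup>2 + 2 * M * (M + D)\<close> of \<open>h\<close>. The 6 is 2 from
  differentiating a square times 3 from bounding the square of a sum of three terms.\<close>

definition growth_rate :: "real \<Rightarrow> real \<Rightarrow> real \<Rightarrow> real" where
  "growth_rate L \<beta> M = 6 * (1 + L * (1 + \<beta>)) * (1 + M\<^sup>2) + 2 * M\<^sup>2 + 2 * M"

lemma growth_rate_pos: "L \<ge> 0 \<Longrightarrow> \<beta> \<ge> 0 \<Longrightarrow> M \<ge> 0 \<Longrightarrow> growth_rate L \<beta> M > 0"
  unfolding growth_rate_def by (intro add_pos_nonneg mult_pos_pos) auto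

text \<open>\<open>P\<close> and \<open>Q\<close> stand for the position and velocity errors,
  \<open>D\<close> for \<open>norm dv\<close>. The summands bound the position cross term, the
  Lipschitz term and the shift of the test vector. \<open>D\<close> occurs only linearly and next to
  \<open>h\<close>, so it can be integrated in time as a forcing of order h.\<close>

lemma growth_rate_absorbs:
  assumes "L \<ge> 0" "\<beta> \<ge> 0" "M \<ge> 0" "0 \<le> h" "h \<le> 1" "P \<ge> 0" "Q \<ge> 0" "D \<ge> 0"
  shows "2 * ((Q + h * M) * P + (L * ((P + h * M) + \<beta> * (Q + h * M)) * (Q + h * M) + (M + D) * (h * M)))
    \<le> growth_rate L \<beta> M * (P\<^sup>2 + Q\<^sup>2) + growth_rate L \<beta> M * h * (1 + D)"
proof -
  define m where "m = h * M"
  define B where "B = 1 + L * (1 + \<beta>)"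
  have m: "0 \<le> m" using assms by (simp add: m_def)
  have B: "B \<ge> 1" using assms by (simp add: B_def)
  have "(Q + m) * P \<le> (P + Q + m) * (P + Q + m)"
    using assms m by (intro mult_mono) auto
  moreover have "L * ((P + m) + \<beta> * (Q + m)) * (Q + m) \<le> (B - 1) * ((P + Q + m) * (P + Q + m))"
  proof -
    have "(P + m) + \<beta> * (Q + m) \<le> (P + Q + m) + \<beta> * (P + Q + m)"
      using assms m by (intro add_mono mult_left_mono) auto
    then have "L * ((P + m) + \<beta> * (Q + m)) * (Q + m) \<le> L * ((P + Q + m) + \<beta> * (P + Q + m)) * (P + Q + m)"
      using assms m by (intro mult_mono mult_left_mono) auto
    then show ?thesis by (simp add: B_def algebra_simps)
  qed
  ultimately have "(Q + m) * P + (L * ((P + m) + \<beta> * (Q + m)) * (Q + m) + (M + D) * m)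
      \<le> B * (P + Q + m)\<^sup>2 + (M + D) * m"
    by (simp add: power2_eq_square left_diff_distrib)
  moreover have "(P + Q + m)\<^sup>2 \<le> 3 * (P\<^sup>2 + Q\<^sup>2 + h * M\<^sup>2)"
  proof -
    \<comment> \<open>\<open>h \<le> 1\<close> trades h^2 for h; the term with \<open>M + D\<close>
      is of first order in any case.\<close>
    have m2: "m\<^sup>2 \<le> h * M\<^sup>2"
      using assms mult_right_mono[of "h * h" h "M\<^sup>2"] mult_left_le_one_le[of h h]
      by (simp add: m_def power2_eq_square mult_ac)
    have "(P + Q + m)\<^sup>2 \<le> 3 * (P\<^sup>2 + Q\<^sup>2 + m\<^sup>2)"
      using zero_le_power2[of "P - Q"] zero_le_power2[of "P - m"] zero_le_power2[of "Q - m"]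
      by (simp add: power2_eq_square algebra_simps)
    also have "\<dots> \<le> 3 * (P\<^sup>2 + Q\<^sup>2 + h * M\<^sup>2)"
      using m2 by simp
    finally show ?thesis .
  qed
  then have "B * (P + Q + m)\<^sup>2 \<le> B * (3 * (P\<^sup>2 + Q\<^sup>2 + h * M\<^sup>2))"
    using B by (intro mult_left_mono) auto
  ultimately have "2 * ((Q + m) * P + (L * ((P + m) + \<beta> * (Q + m)) * (Q + m) + (M + D) * m))
      \<le> 6 * B * (P\<^sup>2 + Q\<^sup>2) + h * (6 * B * M\<^sup>2 + 2 * M * (M + D))"
    by (simp add: m_def algebra_simps power2_eq_square)
  also have "\<dots> \<le> growth_rate L \<beta> M * (P\<^sup>2 + Q\<^sup>2) + h * (growth_rate L \<beta> M * (1 + D))"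
  proof (intro add_mono mult_right_mono mult_left_mono)
    have "6 * B * M\<^sup>2 \<ge> 0" "2 * M\<^sup>2 \<ge> 0" using B by auto
    then show "6 * B \<le> growth_rate L \<beta> M"
      using assms unfolding growth_rate_def B_def[symmetric] by (simp add: algebra_simps)
    have "D * (6 * B * (1 + M\<^sup>2) + 2 * M\<^sup>2) \<ge> 0" using assms B by auto
    then show "6 * B * M\<^sup>2 + 2 * M * (M + D) \<le> growth_rate L \<beta> M * (1 + D)"
      using assms B unfolding growth_rate_def B_def[symmetric]
      by (simp add: algebra_simps power2_eq_square)
  qed (use assms in auto)
  finally show ?thesis by (simp add: m_def mult_ac)
qed

text \<open>The cross term pairs both increments with \<open>w - v\<close>, the difference of the points where the
  subgradients are taken, so that monotonicity removes \<open>\<eta> - \<xi>\<close>; moving from \<open>q + \<tau> c\<close> to \<open>w\<close> costs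
  only \<open>h * norm c\<close>.\<close>

lemma one_step_dissipation:
  fixes G :: "'a::real_inner \<Rightarrow> 'a"
  assumes \<phi>: "proper_ereal \<phi>" and G: "L-lipschitz_on UNIV G"
    and \<gamma>: "\<gamma> \<ge> 0" and \<beta>: "\<beta> \<ge> 0"
    and \<xi>: "\<xi> \<in> subdiff \<phi> v" "dv + \<gamma> *\<^sub>R v + \<xi> + G (x + \<beta> *\<^sub>R v) = 0"
    and \<eta>: "\<eta> \<in> subdiff \<phi> w" "c = - (\<gamma> *\<^sub>R w) - \<eta> - G (p + \<beta> *\<^sub>R q)"
    and w: "w = q + h *\<^sub>R c" and \<tau>: "0 \<le> \<tau>" "\<tau> \<le> h" and h: "h \<le> 1"
    and M: "norm c \<le> M" "norm w \<le> M"
  shows "2 * ((w - v) \<bullet> (p + \<tau> *\<^sub>R w - x)) + 2 * ((c - dv) \<bullet> (q + \<tau> *\<^sub>R c - v))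
    \<le> growth_rate L \<beta> M * ((norm (p + \<tau> *\<^sub>R w - x))\<^sup>2 + (norm (q + \<tau> *\<^sub>R c - v))\<^sup>2)
      + growth_rate L \<beta> M * h * (1 + norm dv)"
proof -
  define P where "P = norm (p + \<tau> *\<^sub>R w - x)"
  define Q where "Q = norm (q + \<tau> *\<^sub>R c - v)"
  have L: "L \<ge> 0" using G by (rule lipschitz_on_nonneg)
  have M0: "M \<ge> 0" using M norm_ge_zero order_trans by blast
  have sc: "norm (s *\<^sub>R y) \<le> h * M" if "\<bar>s\<bar> \<le> h" "norm y \<le> M" for s and y :: 'a
    using that M0 by (simp add: mult_mono)
  have "w - v = (q + \<tau> *\<^sub>R c - v) + (h - \<tau>) *\<^sub>R c" using w by (simp add: algebra_simps)
  then have wv: "norm (w - v) \<le> Q + h * M"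
    unfolding Q_def using \<tau> M by (metis abs_of_nonneg add_left_mono diff_ge_0_iff_ge diff_le_eq
      le_add_same_cancel1 norm_triangle_le sc)
  \<comment> \<open>The scheme evaluates \<open>G\<close> at the left node, so the errors at time
    \<tau> are moved back to \<open>p\<close> and \<open>q\<close>, at a cost of
    \<open>h * M\<close> each.\<close>
  have "q - v = (q + \<tau> *\<^sub>R c - v) - \<tau> *\<^sub>R c" by simp
  then have qv: "norm (q - v) \<le> Q + h * M"
    unfolding Q_def using \<tau> M by (metis abs_of_nonneg add_left_mono norm_triangle_le_diff sc)
  have "p - x = (p + \<tau> *\<^sub>R w - x) - \<tau> *\<^sub>R w" by simp
  then have px: "norm (p - x) \<le> P + h * M"
    unfolding P_def using \<tau> M by (metis abs_of_nonneg add_left_mono norm_triangle_le_diff sc)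
  have "(w - v) \<bullet> (p + \<tau> *\<^sub>R w - x) \<le> norm (w - v) * P"
    unfolding P_def by (rule norm_cauchy_schwarz)
  also have "\<dots> \<le> (Q + h * M) * P"
    using wv by (intro mult_right_mono) (auto simp: P_def)
  finally have 1: "(w - v) \<bullet> (p + \<tau> *\<^sub>R w - x) \<le> (Q + h * M) * P" .
  have 2: "(c - dv) \<bullet> (w - v) \<le> L * ((P + h * M) + \<beta> * (Q + h * M)) * (Q + h * M)"
  proof -
    define g where "g = G (x + \<beta> *\<^sub>R v) - G (p + \<beta> *\<^sub>R q)"
    have dv: "dv = - (\<gamma> *\<^sub>R v) - \<xi> - G (x + \<beta> *\<^sub>R v)"
      using \<xi>(2) by (simp add: algebra_simps eq_neg_iff_add_eq_0)
    have "c - dv = - (\<gamma> *\<^sub>R (w - v)) - (\<eta> - \<xi>) + g"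
      unfolding dv \<eta>(2) g_def by (simp add: algebra_simps)
    then have "(c - dv) \<bullet> (w - v) = - (\<gamma> * ((w - v) \<bullet> (w - v))) - (\<eta> - \<xi>) \<bullet> (w - v) + g \<bullet> (w - v)"
      by (simp add: inner_add_left inner_diff_left)
    also have "\<dots> \<le> g \<bullet> (w - v)"
      using subdiff_monotone[OF \<phi> \<eta>(1) \<xi>(1)] mult_nonneg_nonneg[OF \<gamma> inner_ge_zero[of "w - v"]]
      by linarith
    also have "\<dots> \<le> norm g * norm (w - v)" by (rule norm_cauchy_schwarz)
    also have "\<dots> \<le> (L * ((P + h * M) + \<beta> * (Q + h * M))) * (Q + h * M)"
    proof (intro mult_mono wv)
      have "norm g \<le> L * norm ((p + \<beta> *\<^sub>R q) - (x + \<beta> *\<^sub>R v))"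
        using lipschitz_onD[OF G, of "p + \<beta> *\<^sub>R q" "x + \<beta> *\<^sub>R v"]
        by (simp add: g_def dist_norm norm_minus_commute)
      moreover have "norm ((p + \<beta> *\<^sub>R q) - (x + \<beta> *\<^sub>R v)) \<le> norm (p - x) + \<beta> * norm (q - v)"
      proof -
        have "(p + \<beta> *\<^sub>R q) - (x + \<beta> *\<^sub>R v) = (p - x) + \<beta> *\<^sub>R (q - v)"
          by (simp add: algebra_simps)
        also have "norm \<dots> \<le> norm (p - x) + \<beta> * norm (q - v)"
          using norm_triangle_ineq[of "p - x" "\<beta> *\<^sub>R (q - v)"] \<beta> by simp
        finally show ?thesis .
      qed
      moreover have "\<beta> * norm (q - v) \<le> \<beta> * (Q + h * M)" using qv \<beta> by (rule mult_left_mono)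
      ultimately show "norm g \<le> L * ((P + h * M) + \<beta> * (Q + h * M))"
        using px L by (smt (verit) mult_left_mono)
    qed (use L \<beta> \<tau> M0 in \<open>auto simp: P_def Q_def\<close>)
    finally show ?thesis .
  qed
  have "(c - dv) \<bullet> ((\<tau> - h) *\<^sub>R c) \<le> norm (c - dv) * norm ((\<tau> - h) *\<^sub>R c)"
    by (rule norm_cauchy_schwarz)
  also have "\<dots> \<le> (M + norm dv) * (h * M)"
    using M \<tau> M0 norm_triangle_ineq4[of c dv] by (intro mult_mono sc) auto
  finally have 3: "(c - dv) \<bullet> ((\<tau> - h) *\<^sub>R c) \<le> (M + norm dv) * (h * M)" .
  have "q + \<tau> *\<^sub>R c - v = (w - v) + (\<tau> - h) *\<^sub>R c" using w by (simp add: algebra_simps)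
  then have "(c - dv) \<bullet> (q + \<tau> *\<^sub>R c - v) = (c - dv) \<bullet> (w - v) + (c - dv) \<bullet> ((\<tau> - h) *\<^sub>R c)"
    by (simp only: inner_add_right)
  with 1 2 3 growth_rate_absorbs[of L \<beta> M h P Q "norm dv"] L \<beta> M0 \<tau> h show ?thesis
    by (simp add: P_def Q_def)
qed

text \<open>The dissipation estimate holds off the negligible set \<open>N\<close>, and the energy
  identities turn it into an integral inequality. The forcing integral is enlarged from [a, t] to
  [a, b], so that it is constant in \<open>t\<close> and Gronwall applies.\<close>

lemma one_step_error:
  fixes G :: "'a::{real_inner, banach} \<Rightarrow> 'a"
  defines "F \<equiv> (\<lambda>a p w q c (x :: real \<Rightarrow> 'a) v t.
    (norm (p + (t - a) *\<^sub>R w - x t))\<^sup>2 + (norm (q + (t - a) *\<^sub>R c - v t :: 'a))\<^sup>2)"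
  assumes \<phi>: "proper_ereal \<phi>" and G: "L-lipschitz_on UNIV G"
    and \<gamma>: "\<gamma> \<ge> 0" and \<beta>: "\<beta> \<ge> 0"
    and W: "W12_deriv T x dx" "W12_deriv T v dv"
    and N: "negligible N" "\<And>t. t \<in> {0..T} - N \<Longrightarrow> v t = dx t \<and>
      \<xi> t \<in> subdiff \<phi> (v t) \<and> dv t + \<gamma> *\<^sub>R v t + \<xi> t + G (x t + \<beta> *\<^sub>R v t) = 0"
    and \<eta>: "\<eta> \<in> subdiff \<phi> w" "c = - (\<gamma> *\<^sub>R w) - \<eta> - G (p + \<beta> *\<^sub>R q)"
    and w: "w = q + h *\<^sub>R c" and ab: "0 \<le> a" "a \<le> b" "b \<le> a + h" "b \<le> T" and h: "h \<le> 1"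
    and M: "norm c \<le> M" "norm w \<le> M"
  defines "K \<equiv> growth_rate L \<beta> M"
  shows "F a p w q c x v b \<le> exp (K * (b - a)) *
    (F a p w q c x v a + K * h * integral {a..b} (\<lambda>t. 1 + norm (dv t)))"
proof -
  let ?F = "F a p w q c x v"
  have K: "K > 0"
    unfolding K_def using G \<beta> M norm_ge_zero order_trans
    by (blast intro: growth_rate_pos lipschitz_on_nonneg)
  have xc: "continuous_on {a..b} x" "continuous_on {a..b} v"
    using W ab by (auto simp: W12_deriv_def intro: continuous_on_subset)
  have F: "continuous_on {a..b} ?F"
    unfolding F_def by (intro continuous_intros xc)
  have dvi: "(\<lambda>t. 1 + norm (dv t)) integrable_on {a..b}"
  proof (intro integrable_add integrable_const_ivl)
    show "(\<lambda>t. norm (dv t)) integrable_on {a..b}"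
      by (rule integrable_on_subinterval[OF L2_fun_norm_integrable[of T]])
         (use W ab in \<open>auto simp: W12_deriv_def\<close>)
  qed
  have "?F t \<le> (?F a + K * h * integral {a..b} (\<lambda>t. 1 + norm (dv t))) + K * integral {a..t} ?F"
    if t: "t \<in> {a..b}" for t
  proof -
    have "?F t - ?F a \<le> K * integral {a..t} ?F + K * h * integral {a..t} (\<lambda>t. 1 + norm (dv t))"
    proof (rule has_integral_le_AE[OF N(1)])
      show "((\<lambda>\<tau>. 2 * ((w - dx \<tau>) \<bullet> (p + (\<tau> - a) *\<^sub>R w - x \<tau>)) +
          2 * ((c - dv \<tau>) \<bullet> (q + (\<tau> - a) *\<^sub>R c - v \<tau>))) has_integral ?F t - ?F a) {a..t}"
        using has_integral_add[OF W12_affine_energy[OF W(1), of a t w p] W12_affine_energy[OF W(2), of a t c q]]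
          ab t by (simp add: F_def algebra_simps)
      show "((\<lambda>\<tau>. K * ?F \<tau> + K * h * (1 + norm (dv \<tau>))) has_integral
          K * integral {a..t} ?F + K * h * integral {a..t} (\<lambda>t. 1 + norm (dv t))) {a..t}"
        using t by (intro has_integral_add has_integral_mult_right integrable_integral
            integrable_on_subinterval[OF dvi] integrable_continuous_interval continuous_on_subset[OF F]) auto
      fix \<tau> assume \<tau>: "\<tau> \<in> {a..t} - N"
      with N(2)[of \<tau>] ab t have sol: "dx \<tau> = v \<tau>" "\<xi> \<tau> \<in> subdiff \<phi> (v \<tau>)"
        "dv \<tau> + \<gamma> *\<^sub>R v \<tau> + \<xi> \<tau> + G (x \<tau> + \<beta> *\<^sub>R v \<tau>) = 0" by auto
      show "2 * ((w - dx \<tau>) \<bullet> (p + (\<tau> - a) *\<^sub>R w - x \<tau>)) +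
          2 * ((c - dv \<tau>) \<bullet> (q + (\<tau> - a) *\<^sub>R c - v \<tau>)) \<le> K * ?F \<tau> + K * h * (1 + norm (dv \<tau>))"
        unfolding sol(1) F_def K_def
        by (rule one_step_dissipation[OF \<phi> G \<gamma> \<beta> sol(2,3) \<eta> w _ _ h M]) (use \<tau> t ab in auto)
    qed
    moreover have "integral {a..t} (\<lambda>t. 1 + norm (dv t)) \<le> integral {a..b} (\<lambda>t. 1 + norm (dv t))"
      using t by (intro integral_subset_le dvi integrable_on_subinterval[OF dvi]) auto
    then have "K * h * integral {a..t} (\<lambda>t. 1 + norm (dv t)) \<le> K * h * integral {a..b} (\<lambda>t. 1 + norm (dv t))"
      using K ab by (intro mult_left_mono) auto
    ultimately show ?thesis by linarith
  qed
  from gronwall_integral[OF ab(2) F less_imp_le[OF K] this] show ?thesis .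
qed

section \<open>Global error estimate\<close>

text \<open>Each cell starts with the error reached at the end of the previous one. The exponential
  factors multiply to exp(K t) and the forcing integrals concatenate, so the number of cells does
  not enter the constant.\<close>

lemma scheme_error_square:
  fixes G :: "'a::{real_inner, banach} \<Rightarrow> 'a"
  assumes \<phi>: "proper_ereal \<phi>" and G: "L-lipschitz_on UNIV G"
    and \<gamma>: "\<gamma> \<ge> 0" and \<beta>: "\<beta> \<ge> 0" and T: "T \<ge> 0"
    and init: "x 0 = x0" "v 0 = v0"
    and W: "W12_deriv T x dx" "W12_deriv T v dv"
    and N: "negligible N" "\<And>t. t \<in> {0..T} - N \<Longrightarrow> v t = dx t \<and>
      \<xi> t \<in> subdiff \<phi> (v t) \<and> dv t + \<gamma> *\<^sub>R v t + \<xi> t + G (x t + \<beta> *\<^sub>R v t) = 0"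
    and scheme: "discrete_scheme \<phi> G \<gamma> \<beta> x0 v0 h xs vs" and h: "0 < h" "h \<le> 1"
    and M: "\<And>k. real k * h \<le> T \<Longrightarrow>
      norm ((1 / h) *\<^sub>R (vs (Suc k) - vs k)) \<le> M \<and> norm (vs (Suc k)) \<le> M"
  defines "K \<equiv> growth_rate L \<beta> M"
  assumes t: "real k * h \<le> t" "t \<le> real (Suc k) * h" "t \<le> T"
  shows "(norm (xs k + (t - real k * h) *\<^sub>R vs (Suc k) - x t))\<^sup>2 +
      (norm (vs k + (t - real k * h) *\<^sub>R ((1 / h) *\<^sub>R (vs (Suc k) - vs k)) - v t))\<^sup>2
    \<le> exp (K * t) * (K * h * integral {0..t} (\<lambda>t. 1 + norm (dv t)))"
  using t
proof (induction k arbitrary: t)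
  define I where "I t = integral {0..t} (\<lambda>t. 1 + norm (dv t))" for t
  have dvi: "(\<lambda>t. 1 + norm (dv t)) integrable_on {0..T}"
    using W by (intro integrable_add integrable_const_ivl L2_fun_norm_integrable)
      (auto simp: W12_deriv_def)
  define E where "E k t = (norm (xs k + (t - real k * h) *\<^sub>R vs (Suc k) - x t))\<^sup>2 +
      (norm (vs k + (t - real k * h) *\<^sub>R ((1 / h) *\<^sub>R (vs (Suc k) - vs k)) - v t))\<^sup>2" for k t
  have cell: "E k t \<le> exp (K * t) * (K * h * I t)"
    if start: "E k (real k * h) \<le> exp (K * (real k * h)) * (K * h * I (real k * h))"
      and t: "real k * h \<le> t" "t \<le> real (Suc k) * h" "t \<le> T" for k t
  proof -
    define c where "c = (1 / h) *\<^sub>R (vs (Suc k) - vs k)"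
    define a where "a = real k * h"
    define J where "J = integral {a..t} (\<lambda>t. 1 + norm (dv t))"
    obtain \<eta> where \<eta>: "\<eta> \<in> subdiff \<phi> (vs (Suc k))"
        "c = - (\<gamma> *\<^sub>R vs (Suc k)) - \<eta> - G (xs k + \<beta> *\<^sub>R vs k)"
      using discrete_scheme_step(1)[OF scheme h(1)] unfolding c_def by blast
    have w: "vs (Suc k) = vs k + h *\<^sub>R c" using h by (simp add: c_def)
    have a: "0 \<le> a" "a \<le> t" "t \<le> a + h" using t h by (auto simp: a_def algebra_simps)
    have M': "norm c \<le> M" "norm (vs (Suc k)) \<le> M" using M[of k] t by (auto simp: c_def)
    have "M \<ge> 0" using M'(1) norm_ge_zero order_trans by blast
    with \<beta> lipschitz_on_nonneg[OF G] have K: "K > 0" unfolding K_def by (intro growth_rate_pos)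
    have "E k t \<le> exp (K * (t - a)) * (E k a + K * h * J)"
      using one_step_error[OF \<phi> G \<gamma> \<beta> W N \<eta> w a t(3) h(2) M']
      by (simp add: E_def K_def J_def c_def a_def)
    also have "\<dots> \<le> exp (K * (t - a)) * (exp (K * a) * (K * h * I a) + K * h * J)"
      using start by (simp add: a_def)
    also have "\<dots> \<le> exp (K * (t - a)) * (exp (K * a) * (K * h * I a) + exp (K * a) * (K * h * J))"
    proof -
      have "J \<ge> 0"
        unfolding J_def using a t by (intro integral_nonneg integrable_on_subinterval[OF dvi]) auto
      then have "1 * (K * h * J) \<le> exp (K * a) * (K * h * J)"
        using K a h by (intro mult_right_mono) auto
      then show ?thesis by simp
    qed
    also have "\<dots> = (exp (K * (t - a)) * exp (K * a)) * (K * h * (I a + J))"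
      by (simp add: algebra_simps)
    also have "exp (K * (t - a)) * exp (K * a) = exp (K * t)"
      unfolding exp_add[symmetric] by (simp add: algebra_simps)
    also have "I a + J = I t"
      unfolding I_def J_def using a t
      by (intro Henstock_Kurzweil_Integration.integral_combine integrable_on_subinterval[OF dvi]) auto
    finally show ?thesis .
  qed
  {
    case 0
    have "E 0 0 = 0" using init scheme by (simp add: E_def discrete_scheme_def)
    then show ?case using cell[of 0 t] 0 by (simp add: E_def I_def)
  next
    case (Suc k)
    define s where "s = real (Suc k) * h"
    have "E k s \<le> exp (K * s) * (K * h * I s)"
      unfolding E_def I_def by (rule Suc.IH) (use Suc.prems h in \<open>auto simp: s_def algebra_simps\<close>)
    \<comment> \<open>Continuity of the interpolants: the end of cell \<open>k\<close> is the start
      of cell \<open>Suc k\<close>.\<close>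
    moreover have "E (Suc k) s = E k s"
    proof -
      have "s - real k * h = h" by (simp add: s_def algebra_simps)
      moreover have "vs k + h *\<^sub>R ((1 / h) *\<^sub>R (vs (Suc k) - vs k)) = vs (Suc k)" using h by simp
      moreover have "s - real (Suc k) * h = 0" by (simp add: s_def)
      ultimately show ?thesis
        unfolding E_def discrete_scheme_step(2)[OF scheme h(1), of k] by simp
    qed
    ultimately show ?case
      using cell[of "Suc k" t] Suc.prems unfolding s_def E_def I_def by simp
  }
qed

theorem theorem5p1:
  fixes f :: "'a::{real_inner, banach} \<Rightarrow> real"
    and G :: "'a \<Rightarrow> 'a"
    and \<phi> :: "'a \<Rightarrow> ereal"
    and \<gamma> \<beta> L r :: real
    and x0 v0 :: 'a
    and x v :: "real \<Rightarrow> 'a"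
    and xs vs :: "real \<Rightarrow> nat \<Rightarrow> 'a"
  assumes "\<gamma> > 0" and "\<beta> \<ge> 0"
    and f_C1: "\<And>y. GDERIV f y :> G y" "continuous_on UNIV G"
    and f_bdd: "bdd_below (range f)"
    and L: "L \<ge> 0" "L-lipschitz_on UNIV G"
    and phi: "proper_ereal \<phi>" "lsc_ereal \<phi>" "convex_ereal \<phi>"
    and phi_min: "\<phi> 0 = 0" "\<And>w. \<phi> 0 \<le> \<phi> w"
    and dry: "r > 0" "cball 0 r \<subseteq> subdiff \<phi> 0"
    and v0: "v0 \<in> dom_subdiff \<phi>"
    and sol: "global_strong_solution \<phi> G \<gamma> \<beta> x0 v0 x v"
    and scheme: "\<And>h. h > 0 \<Longrightarrow> discrete_scheme \<phi> G \<gamma> \<beta> x0 v0 h (xs h) (vs h)"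
  shows "\<forall>T>0. \<exists>C>0. \<exists>hT>0. \<forall>h. 0 < h \<and> h \<le> hT \<longrightarrow>
    (SUP t\<in>{0..T}. ereal (norm (interp_x h (xs h) (vs h) t - x t)
                       + norm (interp_v h (vs h) t - v t))) \<le> ereal (C * sqrt h)"
proof (intro allI impI)
  fix T :: real assume T: "T > 0"
  have "strong_solution \<phi> G \<gamma> \<beta> x0 v0 T x v"
    using sol T by (simp add: global_strong_solution_def)
  then obtain dx dv \<xi> where init: "x 0 = x0" "v 0 = v0"
    and W: "W12_deriv T x dx" "W12_deriv T v dv"
    and ae: "AE t in lebesgue_on {0<..<T}. v t = dx t"
      "AE t in lebesgue_on {0<..<T}. \<xi> t \<in> subdiff \<phi> (v t) \<and>
         dv t + \<gamma> *\<^sub>R v t + \<xi> t + G (x t + \<beta> *\<^sub>R v t) = 0"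
    unfolding strong_solution_def by blast
  define N where "N = {t \<in> {0..T}. \<not> (v t = dx t \<and> \<xi> t \<in> subdiff \<phi> (v t) \<and>
      dv t + \<gamma> *\<^sub>R v t + \<xi> t + G (x t + \<beta> *\<^sub>R v t) = 0)}"
  have N: "negligible N"
    unfolding N_def by (rule AE_lebesgue_on_negligible) (use ae in eventually_elim, simp)
  have N': "v t = dx t \<and> \<xi> t \<in> subdiff \<phi> (v t) \<and> dv t + \<gamma> *\<^sub>R v t + \<xi> t + G (x t + \<beta> *\<^sub>R v t) = 0"
    if "t \<in> {0..T} - N" for t
    using that by (auto simp: N_def)
  obtain \<xi>0 where \<xi>0: "\<xi>0 \<in> subdiff \<phi> v0"
    using v0 by (auto simp: dom_subdiff_def)
  define D where "D = norm (\<gamma> *\<^sub>R v0 + \<xi>0 + G (x0 + \<beta> *\<^sub>R v0))"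
  \<comment> \<open>The bound at a node k h <= T with k h replaced by \<open>T\<close>; thus
    \<open>M\<close>, and with it \<open>K\<close>, does not depend on \<open>h\<close>.\<close>
  define M where "M = exp (2 * (1 + L * (1 + \<beta>)) * T) * (2 * D + norm v0)"
  define K where "K = growth_rate L \<beta> M"
  define I where "I t = integral {0..t} (\<lambda>t. 1 + norm (dv t))" for t
  \<comment> \<open>The 2 comes from (p + q)^2 <= 2 (p^2 + q^2), which passes from the sum of
    squares to the sum of the two errors.\<close>
  define A where "A = 2 * (exp (K * T) * (K * I T))"
  have "M \<ge> 0" by (simp add: M_def D_def)
  then have K: "K > 0" using L \<open>\<beta> \<ge> 0\<close> by (simp add: K_def growth_rate_pos)
  have dvi: "(\<lambda>t. 1 + norm (dv t)) integrable_on {0..T}"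
    using W by (intro integrable_add integrable_const_ivl L2_fun_norm_integrable)
      (auto simp: W12_deriv_def)
  have I_mono: "I t \<le> I T" if "t \<in> {0..T}" for t
    unfolding I_def using that
    by (intro integral_subset_le dvi integrable_on_subinterval[OF dvi]) auto
  have I0: "I t \<ge> 0" if "t \<in> {0..T}" for t
    unfolding I_def using that by (intro integral_nonneg integrable_on_subinterval[OF dvi]) auto
  have A: "A \<ge> 0" using K I0[of T] T by (simp add: A_def)
  have main: "norm (interp_x h (xs h) (vs h) t - x t) + norm (interp_v h (vs h) t - v t) \<le> sqrt A * sqrt h"
    if h: "0 < h" "h \<le> 1" and t: "t \<in> {0..T}" for h t
  proof -
    define k where "k = nat \<lfloor>t / h\<rfloor>"
    have "real k = of_int \<lfloor>t / h\<rfloor>" using t h by (simp add: k_def)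
    then have "real k \<le> t / h" "t / h \<le> real k + 1" by linarith+
    then have tk: "real k * h \<le> t" "t \<le> real (Suc k) * h"
      using h by (auto simp: field_simps)
    have M: "norm ((1 / h) *\<^sub>R (vs h (Suc k) - vs h k)) \<le> M \<and> norm (vs h (Suc k)) \<le> M"
      if "real k * h \<le> T" for k
    proof -
      have "norm ((1 / h) *\<^sub>R (vs h (Suc k) - vs h k)) + norm (vs h (Suc k))
          \<le> exp (2 * (1 + L * (1 + \<beta>)) * (real k * h)) * (2 * D + norm v0)"
        by (rule discrete_scheme_bounds[OF phi(1) L(2) _ \<open>\<beta> \<ge> 0\<close> \<xi>0 scheme[OF h(1)] h])
           (use \<open>\<gamma> > 0\<close> in \<open>auto simp: D_def\<close>)
      also have "\<dots> \<le> M"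
        unfolding M_def using that L \<open>\<beta> \<ge> 0\<close>
        by (intro mult_right_mono) (auto simp: D_def intro!: mult_left_mono)
      finally have "norm ((1 / h) *\<^sub>R (vs h (Suc k) - vs h k)) + norm (vs h (Suc k)) \<le> M" .
      then show ?thesis
        using norm_ge_zero[of "(1 / h) *\<^sub>R (vs h (Suc k) - vs h k)"] norm_ge_zero[of "vs h (Suc k)"]
        by linarith
    qed
    define p q where "p = norm (interp_x h (xs h) (vs h) t - x t)" and "q = norm (interp_v h (vs h) t - v t)"
    have "p\<^sup>2 + q\<^sup>2 \<le> exp (K * t) * (K * h * I t)"
      using scheme_error_square[OF phi(1) L(2) less_imp_le[OF \<open>\<gamma> > 0\<close>] \<open>\<beta> \<ge> 0\<close> less_imp_le[OF T]
          init W N N' scheme[OF h(1)] h M tk] t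
      by (simp add: p_def q_def interp_x_def interp_v_def k_def[symmetric] Let_def K_def I_def)
    also have "\<dots> \<le> exp (K * T) * (K * h * I T)"
      using K h t I_mono[OF t] I0[OF t] by (intro mult_mono) auto
    finally have "2 * (p\<^sup>2 + q\<^sup>2) \<le> A * h" by (simp add: A_def mult_ac)
    moreover have "(p + q)\<^sup>2 \<le> 2 * (p\<^sup>2 + q\<^sup>2)"
      using zero_le_power2[of "p - q"] by (simp add: power2_eq_square algebra_simps)
    ultimately have "p + q \<le> sqrt (A * h)" by (intro real_le_rsqrt) linarith
    then show ?thesis by (simp add: p_def q_def real_sqrt_mult)
  qed
  \<comment> \<open>The threshold 1 is inherited from the discrete bounds and the one-step estimate;
    the \<open>+ 1\<close> makes the constant positive, given \<open>A \<ge> 0\<close>.\<close>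
  have "\<forall>h. 0 < h \<and> h \<le> 1 \<longrightarrow> (SUP t\<in>{0..T}. ereal (norm (interp_x h (xs h) (vs h) t - x t)
      + norm (interp_v h (vs h) t - v t))) \<le> ereal ((sqrt A + 1) * sqrt h)"
  proof (intro allI impI SUP_least)
    fix h t :: real assume "0 < h \<and> h \<le> 1" "t \<in> {0..T}"
    with main[of h t] show "ereal (norm (interp_x h (xs h) (vs h) t - x t)
        + norm (interp_v h (vs h) t - v t)) \<le> ereal ((sqrt A + 1) * sqrt h)"
      by (simp add: distrib_right add_increasing2)
  qed
  moreover have "sqrt A + 1 > 0" using A by (simp add: add_nonneg_pos)
  ultimately show "\<exists>C>0. \<exists>hT>0. \<forall>h. 0 < h \<and> h \<le> hT \<longrightarrow>
    (SUP t\<in>{0..T}. ereal (norm (interp_x h (xs h) (vs h) t - x t)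
                       + norm (interp_v h (vs h) t - v t))) \<le> ereal (C * sqrt h)"
    using zero_less_one by blast
qed

end
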